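(* Let $N>3$, let $\tau\in\{1,\dots,N-1\}$, and let fixed numbers $\alpha_\mu<0$ be given for all $\mu\in\{1,\dots,N-1\}\setminus\{\tau\}$. Put $|\alpha_\sigma|:=\min\{|\alpha_\mu| : 1\le\mu\le N-1,\ \mu\neq\tau\}$ and $$\alpha_{(d)}:=\Big(\sum_{\mu=1,\,\mu\ne\tau}^{N-1}|\alpha_\mu|^{-1}\Big)^{-1}.$$ Let $\alpha_\tau<0$ satisfy $0<|\alpha_\tau|\le|\alpha_\sigma|$, and consider the $\alpha_0$-family of spin polygons with couplings $\alpha_0,\alpha_1,\dots,\alpha_{N-1}$, where $\alpha_0$ ranges over $(0,\infty)$. Then: (i) The equation $$\sum_{\mu=1,\,\mu\neq\tau}^{N-1}\arcsin\frac{x}{|\alpha_\mu|}=\frac{\pi}{2}$$ has a unique solution $x=\alpha_{(d')}$, and it satisfies $0<\alpha_{(d)}<\alpha_{(d')}<|\alpha_\sigma|$. (ii) $0<|\alpha_\tau|<\alpha_{(d)}$ if and only if the $\alpha_0$-family is of type II. (iii) $\alpha_{(d)}\le|\alpha_\tau|<\alpha_{(d')}$ if and only if the $\alpha_0$-family is of type I$_\beta$. (iv) $\alpha_{(d')}\le|\alpha_\tau|\le|\alpha_\sigma|$ if and only if the $\alpha_0$-family is of type I$_\alpha$.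
   Context: Spin polygon: unit vectors $\mathbf{s}_0,\dots,\mathbf{s}_{N-1}\in\mathbb{R}^3$ (indices modulo $N$) with energy $E=\sum_{\mu=0}^{N-1}\alpha_\mu\,\mathbf{s}_\mu\cdot\mathbf{s}_{\mu+1}$, where $\alpha_0>0$ and $\alpha_\mu<0$ for $0<\mu<N$. A lowest energy configuration (LEC) is a global minimizer of $E$. A configuration is collinear (coplanar) if its vectors span a one-dimensional (two-dimensional) subspace; every LEC is either collinear or coplanar. Angles: an LEC may be placed in a plane and written $\mathbf{s}_\mu=(\cos\phi_\mu,\sin\phi_\mu)$; let $\psi_\mu\in(-\pi,\pi]$ be the representative of $\phi_{\mu+1}-\phi_\mu$ modulo $2\pi$, and $\Psi:=\sum_{\mu=1}^{N-1}\psi_\mu$. Then $E=\alpha_0\cos\Psi-\sum_{\mu=1}^{N-1}|\alpha_\mu|\cos\psi_\mu$. By reversing all angles if necessary one assumes $\sin\Psi\ge 0$. The Lagrange parameter of the LEC is $\beta:=\alpha_0\sin\Psi\ge 0$ (and it equals $0$ for collinear LECs). With the coefficients $\alpha_1,\dots,\alpha_{N-1}$ fixed, $\beta$ is regarded as a function $\beta(\alpha_0)$ of $\alpha_0\in(0,\infty)$ (neither $\beta(\alpha_0)$ nor the alternative collinear/coplanar depends on the choice of the LEC). Types: a phase transition of the $\alpha_0$-family is a value of $\alpha_0\in(0,\infty)$ at which, as $\alpha_0$ varies, the LEC changes between collinear and coplanar. The $\alpha_0$-family is of type I if exactly one phase transition occurs, and of type II otherwise. A family of type I is of type I$_\beta$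 if the function $\alpha_0\mapsto\beta(\alpha_0)$ on $(0,\infty)$ has (attains) a maximum, and of type I$_\alpha$ otherwise. *)

theory Defs
  imports "HOL-Analysis.Analysis"
begin

text \<open>
  A spin polygon is a function \<open>s :: nat \<Rightarrow> real ^ 3\<close>, of which only the values at indices
  below \<open>N\<close> matter; likewise only these values of the couplings \<open>\<alpha> :: nat \<Rightarrow> real\<close> matter.
\<close>

definition spin_config :: "nat \<Rightarrow> (nat \<Rightarrow> real ^ 3) \<Rightarrow> bool" where
  "spin_config N s \<longleftrightarrow> (\<forall>\<mu><N. norm (s \<mu>) = 1)"

definition energy :: "nat \<Rightarrow> (nat \<Rightarrow> real) \<Rightarrow> (nat \<Rightarrow> real ^ 3) \<Rightarrow> real" where
  "energy N \<alpha> s = (\<Sum>\<mu><N. \<alpha> \<mu> * (s \<mu> \<bullet> s (Suc \<mu> mod N)))"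

definition is_LEC :: "nat \<Rightarrow> (nat \<Rightarrow> real) \<Rightarrow> (nat \<Rightarrow> real ^ 3) \<Rightarrow> bool" where
  "is_LEC N \<alpha> s \<longleftrightarrow>
     spin_config N s \<and> (\<forall>t. spin_config N t \<longrightarrow> energy N \<alpha> s \<le> energy N \<alpha> t)"

text \<open>
  Collinearity and coplanarity are linear notions here, so the affine predicate
  \<open>collinear\<close> of the library is not the right one.
\<close>

definition collinear_config :: "nat \<Rightarrow> (nat \<Rightarrow> real ^ 3) \<Rightarrow> bool" where
  "collinear_config N s \<longleftrightarrow> dim (span (s ` {..<N})) = 1"

definition coplanar_config :: "nat \<Rightarrow> (nat \<Rightarrow> real ^ 3) \<Rightarrow> bool" where
  "coplanar_config N s \<longleftrightarrow> dim (span (s ` {..<N})) = 2"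

text \<open>
  Lowest energy configurations exist by compactness, so the universal quantifiers below are
  not vacuous.
\<close>

definition LEC_collinear :: "nat \<Rightarrow> (nat \<Rightarrow> real) \<Rightarrow> bool" where
  "LEC_collinear N \<alpha> \<longleftrightarrow> (\<forall>s. is_LEC N \<alpha> s \<longrightarrow> collinear_config N s)"

definition LEC_coplanar :: "nat \<Rightarrow> (nat \<Rightarrow> real) \<Rightarrow> bool" where
  "LEC_coplanar N \<alpha> \<longleftrightarrow> (\<forall>s. is_LEC N \<alpha> s \<longrightarrow> coplanar_config N s)"

definition planar_angles :: "nat \<Rightarrow> (nat \<Rightarrow> real ^ 3) \<Rightarrow> (nat \<Rightarrow> real) \<Rightarrow> bool" where
  "planar_angles N s \<phi> \<longleftrightarrow>
     (\<exists>u v. norm u = 1 \<and> norm v = 1 \<and> u \<bullet> v = 0 \<and>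
        (\<forall>\<mu><N. s \<mu> = cos (\<phi> \<mu>) *\<^sub>R u + sin (\<phi> \<mu>) *\<^sub>R v))"

text \<open>The representative of \<open>x\<close> modulo \<open>2\<pi>\<close> in the half-open interval from \<open>-\<pi>\<close> (excluded) to \<open>\<pi>\<close>:\<close>

definition principal_angle :: "real \<Rightarrow> real" where
  "principal_angle x = Arg (cis x)"

lemma principal_angle_unique:
  "principal_angle x = y \<longleftrightarrow> - pi < y \<and> y \<le> pi \<and> (\<exists>k::int. y = x + 2 * pi * k)"
proof
  assume y: "principal_angle x = y"
  have "cis y = cis x"
    using y cis_Arg[of "cis x"] by (simp add: principal_angle_def sgn_div_norm)
  then have "exp (\<i> * of_real y) = exp (\<i> * of_real x)"
    by (simp add: cis_conv_exp)
  then obtain k :: int where "\<i> * of_real y = \<i> * of_real x + of_int (2 * k) * pi * \<i>"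
    by (auto simp: exp_eq)
  then have "Im (\<i> * of_real y) = Im (\<i> * of_real x + of_int (2 * k) * pi * \<i>)"
    by simp
  then have "y = x + 2 * pi * k" by (simp add: algebra_simps)
  then show "- pi < y \<and> y \<le> pi \<and> (\<exists>k::int. y = x + 2 * pi * k)"
    using y Arg_bounded[of "cis x"] by (auto simp: principal_angle_def)
next
  assume a: "- pi < y \<and> y \<le> pi \<and> (\<exists>k::int. y = x + 2 * pi * k)"
  then obtain k :: int where k: "y = x + 2 * pi * k" by blast
  have "cis y = cis x" unfolding k by (simp add: cis_mult[symmetric])
  then show "principal_angle x = y"
    using a by (auto simp: principal_angle_def sgn_div_norm intro!: cis_Arg_unique)
qed

definition total_angle :: "nat \<Rightarrow> (nat \<Rightarrow> real) \<Rightarrow> real" where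
  "total_angle N \<phi> = (\<Sum>\<mu> = 1..N - 1. principal_angle (\<phi> (Suc \<mu> mod N) - \<phi> \<mu>))"

definition is_lagrange_param :: "nat \<Rightarrow> (nat \<Rightarrow> real) \<Rightarrow> real \<Rightarrow> bool" where
  "is_lagrange_param N \<alpha> b \<longleftrightarrow>
     (\<exists>s \<phi>. is_LEC N \<alpha> s \<and> planar_angles N s \<phi> \<and>
        sin (total_angle N \<phi>) \<ge> 0 \<and> b = \<alpha> 0 * sin (total_angle N \<phi>))"

text \<open>
  In what follows \<open>\<alpha>\<close> stands for the whole \<open>\<alpha>\<^sub>0\<close>-family: its value at \<open>0\<close> is replaced by the
  family parameter \<open>a\<close>.
\<close>

definition lagrange_param :: "nat \<Rightarrow> (nat \<Rightarrow> real) \<Rightarrow> real \<Rightarrow> real" where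
  "lagrange_param N \<alpha> a = (THE b. is_lagrange_param N (\<alpha>(0 := a)) b)"

text \<open>
  A phase transition is a parameter value arbitrarily close to which both alternatives occur.
\<close>

definition phase_transition :: "nat \<Rightarrow> (nat \<Rightarrow> real) \<Rightarrow> real \<Rightarrow> bool" where
  "phase_transition N \<alpha> a \<longleftrightarrow>
     a > 0 \<and>
     a \<in> closure {a'. a' > 0 \<and> LEC_collinear N (\<alpha>(0 := a'))} \<and>
     a \<in> closure {a'. a' > 0 \<and> LEC_coplanar N (\<alpha>(0 := a'))}"

definition type_I :: "nat \<Rightarrow> (nat \<Rightarrow> real) \<Rightarrow> bool" where
  "type_I N \<alpha> \<longleftrightarrow> (\<exists>!a. phase_transition N \<alpha> a)"

definition type_II :: "nat \<Rightarrow> (nat \<Rightarrow> real) \<Rightarrow> bool" where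
  "type_II N \<alpha> \<longleftrightarrow> \<not> type_I N \<alpha>"

definition type_I_beta :: "nat \<Rightarrow> (nat \<Rightarrow> real) \<Rightarrow> bool" where
  "type_I_beta N \<alpha> \<longleftrightarrow> type_I N \<alpha> \<and>
     (\<exists>a>0. \<forall>a'>0. lagrange_param N \<alpha> a' \<le> lagrange_param N \<alpha> a)"

definition type_I_alpha :: "nat \<Rightarrow> (nat \<Rightarrow> real) \<Rightarrow> bool" where
  "type_I_alpha N \<alpha> \<longleftrightarrow> type_I N \<alpha> \<and> \<not> type_I_beta N \<alpha>"

definition alpha_sigma :: "nat \<Rightarrow> nat \<Rightarrow> (nat \<Rightarrow> real) \<Rightarrow> real" where
  "alpha_sigma N \<tau> \<alpha> = Min ((\<lambda>\<mu>. \<bar>\<alpha> \<mu>\<bar>) ` ({1..N - 1} - {\<tau>}))"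

definition alpha_d :: "nat \<Rightarrow> nat \<Rightarrow> (nat \<Rightarrow> real) \<Rightarrow> real" where
  "alpha_d N \<tau> \<alpha> = inverse (\<Sum>\<mu> \<in> {1..N - 1} - {\<tau>}. inverse \<bar>\<alpha> \<mu>\<bar>)"

text \<open>
  The domain condition is needed because \<open>arcsin\<close> has unspecified values outside \<open>{-1..1}\<close>.
\<close>

definition arcsin_sum_eq :: "nat \<Rightarrow> nat \<Rightarrow> (nat \<Rightarrow> real) \<Rightarrow> real \<Rightarrow> bool" where
  "arcsin_sum_eq N \<tau> \<alpha> x \<longleftrightarrow>
     (\<forall>\<mu> \<in> {1..N - 1} - {\<tau>}. x / \<bar>\<alpha> \<mu>\<bar> \<in> {-1..1}) \<and>
     (\<Sum>\<mu> \<in> {1..N - 1} - {\<tau>}. arcsin (x / \<bar>\<alpha> \<mu>\<bar>)) = pi / 2"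

definition alpha_d' :: "nat \<Rightarrow> nat \<Rightarrow> (nat \<Rightarrow> real) \<Rightarrow> real" where
  "alpha_d' N \<tau> \<alpha> = (THE x. arcsin_sum_eq N \<tau> \<alpha> x)"

end

theory Submission
  imports Defs
begin

text \<open>
  Write \<open>c\<^sub>\<mu> = |\<alpha>\<^sub>\<mu>|\<close> and \<open>a = \<alpha>\<^sub>0\<close>. Angles \<open>\<theta>\<^sub>\<mu> > 0\<close> of sum \<open>\<Psi> < \<pi>\<close> with
  \<open>c\<^sub>\<mu> sin \<theta>\<^sub>\<mu> = a sin \<Psi> = \<beta>\<close> give a global minimizer: the energy excess of any configuration is
  \<open>\<beta>\<close> times the difference between \<open>\<Sum>\<^sub>\<mu> (cos \<theta>\<^sub>\<mu> - s\<^sub>\<mu> \<bullet> s\<^bsub>\<mu>+1\<^esub>) / sin \<theta>\<^sub>\<mu>\<close> and the same expression for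
  the single step from \<open>s\<^sub>1\<close> to \<open>s\<^sub>0\<close> with angle \<open>\<Psi>\<close>. Each summand is, up to constants, the action of
  a harmonic oscillator moving from \<open>s\<^sub>\<mu>\<close> to \<open>s\<^bsub>\<mu>+1\<^esub>\<close> in time \<open>\<theta>\<^sub>\<mu>\<close>, so prescribing intermediate
  points can only increase the total; equality forces coplanarity and \<open>s\<^sub>0 \<bullet> s\<^sub>1 = cos \<Psi>\<close>, whence \<open>\<beta>\<close> is
  unique. If on the other hand \<open>a\<close> is at most \<open>a\<^sub>0 = (\<Sum>\<^sub>\<mu> 1/c\<^sub>\<mu>)\<^sup>-\<^sup>1\<close>, or if \<open>c\<^sub>\<tau> (1/a + 1/\<alpha>\<^sub>d) \<le> 1\<close>, then
  the Cauchy inequality applied to the sides of the polygon shows that all minimizers are collinear.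

  As no angle but \<open>\<theta>\<^sub>\<tau>\<close> can exceed \<open>\<pi>/2\<close>, the critical angles are parametrized by \<open>t = \<theta>\<^sub>\<tau>\<close>, with
  \<open>\<beta> = c\<^sub>\<tau> sin t\<close> and \<open>\<Psi> = t + g t\<close>. For all other values of \<open>a\<close> a suitable \<open>t\<close> exists, by comparing
  slopes at \<open>t = 0\<close> and \<open>t = \<pi>\<close>. The largest conceivable value \<open>\<beta> = c\<^sub>\<tau>\<close> is attained at \<open>t = \<pi>/2\<close>
  provided that \<open>g (\<pi>/2) < \<pi>/2\<close>, which means \<open>c\<^sub>\<tau> < \<alpha>\<^bsub>d'\<^esub>\<close>; otherwise \<open>t < \<pi>/2\<close> throughout, and \<open>\<beta>\<close> can
  always be increased by increasing \<open>t\<close>.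
\<close>

section \<open>Chains of unit vectors\<close>

text \<open>The squared vector vanishes exactly when \<open>y\<close> obeys the formula for
  spherical interpolation between \<open>x\<close> and \<open>z\<close>, at angle \<open>A\<close>
  from \<open>x\<close> and \<open>B\<close> from \<open>z\<close>. After clearing denominators only
  two facts are needed: the addition theorem, and the law of cosines for a triangle with sides
  \<open>sin A\<close>, \<open>sin B\<close>, \<open>sin (A + B)\<close>.\<close>

lemma unit_triple_identity:
  fixes x y z :: "'a::real_inner"
  assumes u: "norm x = 1" "norm y = 1" "norm z = 1"
    and A: "sin A \<noteq> 0" "sin B \<noteq> 0" "sin (A + B) \<noteq> 0"
  shows "(cos A - x \<bullet> y) / sin A + (cos B - y \<bullet> z) / sin B - (cos (A + B) - x \<bullet> z) / sin (A + B)
    = (norm (sin (A + B) *\<^sub>R y - sin B *\<^sub>R x - sin A *\<^sub>R z))\<^sup>2 / (2 * sin A * sin B * sin (A + B))"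
proof -
  define S where "S = sin (A + B)"
  have xx: "x \<bullet> x = 1" "y \<bullet> y = 1" "z \<bullet> z = 1"
    using u by (simp_all add: dot_square_norm)
  have n: "(norm (S *\<^sub>R y - sin B *\<^sub>R x - sin A *\<^sub>R z))\<^sup>2
    = S\<^sup>2 + (sin B)\<^sup>2 + (sin A)\<^sup>2 - 2 * S * sin B * (x \<bullet> y) - 2 * S * sin A * (y \<bullet> z) + 2 * sin A * sin B * (x \<bullet> z)"
    unfolding power2_norm_eq_inner
    by (simp add: inner_diff_left inner_diff_right xx inner_commute algebra_simps power2_eq_square)
  have 1: "(sin A)\<^sup>2 + (sin B)\<^sup>2 = S\<^sup>2 - 2 * sin A * sin B * cos (A + B)"
  proof -
    have "sin A = S * cos B - cos (A + B) * sin B" "sin B = S * cos A - cos (A + B) * sin A"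
      using sin_diff[of "A + B" B] sin_diff[of "A + B" A] by (simp_all add: S_def)
    moreover have "S = sin A * cos B + cos A * sin B" by (simp add: S_def sin_add)
    ultimately show ?thesis by algebra
  qed
  have 2: "cos A * sin B + cos B * sin A = S" by (simp add: S_def sin_add)
  have "((cos A - x \<bullet> y) / sin A + (cos B - y \<bullet> z) / sin B - (cos (A + B) - x \<bullet> z) / S) * (2 * sin A * sin B * S)
     = 2 * S * (cos A * sin B + cos B * sin A) - 2 * sin A * sin B * cos (A + B)
       - 2 * S * sin B * (x \<bullet> y) - 2 * S * sin A * (y \<bullet> z) + 2 * sin A * sin B * (x \<bullet> z)"
    using A unfolding S_def[symmetric] by (simp add: field_simps)
  also have "\<dots> = (norm (S *\<^sub>R y - sin B *\<^sub>R x - sin A *\<^sub>R z))\<^sup>2"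
    unfolding n 2 using 1 by (simp add: power2_eq_square algebra_simps)
  finally show ?thesis using A unfolding S_def[symmetric] by (simp add: eq_divide_eq)
qed

text \<open>Steps are merged from the left: the first \<open>m\<close> steps are compared with one
  step from \<open>p 1\<close> to \<open>p (Suc m)\<close>, and merging in the next step adds the
  nonnegative square from \<open>unit_triple_identity\<close>. If \<open>D = 0\<close>, all these
  squares vanish, which is the list of interpolation relations.\<close>

lemma unit_chain_defect:
  fixes p :: "nat \<Rightarrow> 'a::real_inner"
  assumes "1 \<le> m" "\<And>k. k \<in> {1..Suc m} \<Longrightarrow> norm (p k) = 1"
    and "\<And>k. k \<in> {1..m} \<Longrightarrow> 0 < \<theta> k" "sum \<theta> {1..m} < pi"
  defines "D \<equiv> (\<Sum>k = 1..m. (cos (\<theta> k) - p k \<bullet> p (Suc k)) / sin (\<theta> k))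
       - (cos (sum \<theta> {1..m}) - p 1 \<bullet> p (Suc m)) / sin (sum \<theta> {1..m})"
  shows "0 \<le> D \<and> (D = 0 \<longrightarrow> (\<forall>k \<in> {2..m}.
    sin (sum \<theta> {1..k}) *\<^sub>R p k = sin (\<theta> k) *\<^sub>R p 1 + sin (sum \<theta> {1..k - 1}) *\<^sub>R p (Suc k)))"
  using assms(1-4) unfolding D_def
proof (induction m rule: dec_induct)
  case base
  then show ?case by simp
next
  case (step m)
  let ?P = "sum \<theta> {1..m}" and ?P' = "sum \<theta> {1..Suc m}"
  let ?G = "\<lambda>m. (\<Sum>k = 1..m. (cos (\<theta> k) - p k \<bullet> p (Suc k)) / sin (\<theta> k))"
  let ?E = "\<lambda>m. (cos (sum \<theta> {1..m}) - p 1 \<bullet> p (Suc m)) / sin (sum \<theta> {1..m})"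
  define V where "V = sin ?P' *\<^sub>R p (Suc m) - sin (\<theta> (Suc m)) *\<^sub>R p 1 - sin ?P *\<^sub>R p (Suc (Suc m))"
  have P': "?P' = ?P + \<theta> (Suc m)" by simp
  have pos: "0 < ?P" using step.hyps step.prems by (intro sum_pos) auto
  have "0 < \<theta> (Suc m)" using step.prems by auto
  then have s: "0 < sin ?P" "0 < sin (\<theta> (Suc m))" "0 < sin ?P'"
    using pos step.prems(3) P' by (auto intro!: sin_gt_zero)
  have IH: "0 \<le> ?G m - ?E m \<and> (?G m - ?E m = 0 \<longrightarrow> (\<forall>k \<in> {2..m}.
    sin (sum \<theta> {1..k}) *\<^sub>R p k = sin (\<theta> k) *\<^sub>R p 1 + sin (sum \<theta> {1..k - 1}) *\<^sub>R p (Suc k)))"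
    proof (intro step.IH)
    show "?P < pi" using step.prems(3) P' \<open>0 < \<theta> (Suc m)\<close> by linarith
  qed (use step.prems in auto)
  have eq: "?G (Suc m) - ?E (Suc m) = (?G m - ?E m)
      + (norm V)\<^sup>2 / (2 * sin ?P * sin (\<theta> (Suc m)) * sin ?P')"
    using unit_triple_identity[of "p 1" "p (Suc m)" "p (Suc (Suc m))" ?P "\<theta> (Suc m)"]
      step.hyps step.prems(1) s unfolding P' V_def by simp
  have nn: "0 \<le> (norm V)\<^sup>2 / (2 * sin ?P * sin (\<theta> (Suc m)) * sin ?P')"
    using s by simp
  show ?case
  proof (intro conjI impI ballI)
    show "0 \<le> ?G (Suc m) - ?E (Suc m)" using IH nn unfolding eq by linarith
    fix k
    assume z: "?G (Suc m) - ?E (Suc m) = 0" and k: "k \<in> {2..Suc m}"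
    have z': "?G m - ?E m = 0" "(norm V)\<^sup>2 / (2 * sin ?P * sin (\<theta> (Suc m)) * sin ?P') = 0"
      using z eq IH nn by linarith+
    then have "V = 0" using s by simp
    show "sin (sum \<theta> {1..k}) *\<^sub>R p k = sin (\<theta> k) *\<^sub>R p 1 + sin (sum \<theta> {1..k - 1}) *\<^sub>R p (Suc k)"
    proof (cases "k = Suc m")
      case True
      then show ?thesis using \<open>V = 0\<close> by (simp add: V_def algebra_simps)
    next
      case False
      then have "k \<in> {2..m}" using k by auto
      then show ?thesis using IH z'(1) by blast
    qed
  qed
qed

text \<open>Springs in series: for a prescribed sum \<open>D\<close> the weighted square sum is
  least when each \<open>d k\<close> is the share of \<open>D\<close> proportional to
  \<open>inverse (c k)\<close>, and the last sum is the exact excess over this minimum.\<close>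

lemma sum_weighted_norm_square:
  fixes d :: "'b \<Rightarrow> 'a::real_inner"
  assumes "finite K" "K \<noteq> {}" "\<And>k. k \<in> K \<Longrightarrow> 0 < c k"
  defines "R \<equiv> \<Sum>k\<in>K. inverse (c k)" and "D \<equiv> \<Sum>k\<in>K. d k"
  shows "(\<Sum>k\<in>K. c k * (norm (d k))\<^sup>2) =
    (norm D)\<^sup>2 / R + (\<Sum>k\<in>K. c k * (norm (d k - (inverse (c k) / R) *\<^sub>R D))\<^sup>2)"
proof -
  have R: "R > 0" unfolding R_def using assms(1-3) by (intro sum_pos) auto
  have "c k * (norm (d k - (inverse (c k) / R) *\<^sub>R D))\<^sup>2
     = c k * (norm (d k))\<^sup>2 - (2 / R) * (d k \<bullet> D) + inverse (c k) * ((norm D)\<^sup>2 / R\<^sup>2)" if "k \<in> K" for k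
    using assms(3)[OF that] R unfolding power2_norm_eq_inner
    by (simp add: inner_diff_left inner_diff_right inner_commute field_simps power2_eq_square)
  then have "(\<Sum>k\<in>K. c k * (norm (d k - (inverse (c k) / R) *\<^sub>R D))\<^sup>2)
    = (\<Sum>k\<in>K. c k * (norm (d k))\<^sup>2 - (2 / R) * (d k \<bullet> D) + inverse (c k) * ((norm D)\<^sup>2 / R\<^sup>2))"
    by (intro sum.cong) auto
  also have "\<dots> = (\<Sum>k\<in>K. c k * (norm (d k))\<^sup>2) - (2 / R) * (D \<bullet> D) + R * ((norm D)\<^sup>2 / R\<^sup>2)"
    by (simp only: sum.distrib sum_subtractf sum_distrib_left[symmetric]
        sum_distrib_right[symmetric] inner_sum_left[symmetric] R_def[symmetric] D_def[symmetric])
  finally show ?thesis using R by (simp add: dot_square_norm power2_eq_square field_simps)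
qed

section \<open>Planar configurations and the Lagrange parameter\<close>

lemma planar_angles_inner:
  assumes "planar_angles N s \<phi>" "j < N" "k < N"
  shows "s j \<bullet> s k = cos (\<phi> j - \<phi> k)"
proof -
  obtain u v where uv: "norm u = 1" "norm v = 1" "u \<bullet> v = 0"
    and s: "\<And>\<mu>. \<mu> < N \<Longrightarrow> s \<mu> = cos (\<phi> \<mu>) *\<^sub>R u + sin (\<phi> \<mu>) *\<^sub>R v"
    using assms(1) unfolding planar_angles_def by blast
  have "u \<bullet> u = 1" "v \<bullet> v = 1" "v \<bullet> u = 0"
    using uv by (simp_all add: dot_square_norm inner_commute)
  then show ?thesis using uv(3) assms(2,3)
    by (simp add: s inner_add_left inner_add_right cos_diff)
qed

text \<open>Principal angles differ from the raw differences by multiples of \<open>2 * pi\<close>,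
  and the raw differences telescope because the last successor index wraps to 0.\<close>

lemma cos_total_angle:
  assumes "N > 1"
  shows "cos (total_angle N \<phi>) = cos (\<phi> 0 - \<phi> 1)"
proof -
  have "\<forall>x. \<exists>k::int. principal_angle x = x + 2 * pi * k"
    using principal_angle_unique[THEN iffD1, OF refl] by blast
  from choice[OF this] obtain K :: "real \<Rightarrow> int"
    where K: "\<And>x. principal_angle x = x + 2 * pi * K x" by blast
  let ?x = "\<lambda>\<mu>. \<phi> (Suc \<mu> mod N) - \<phi> \<mu>"
  have "total_angle N \<phi> = (\<Sum>\<mu> = 1..N - 1. ?x \<mu>) + 2 * pi * of_int (\<Sum>\<mu> = 1..N - 1. K (?x \<mu>))"
    by (simp add: total_angle_def K sum.distrib sum_distrib_left)
  also have "(\<Sum>\<mu> = 1..N - 1. ?x \<mu>) = (\<Sum>\<mu> = 1..N - 1. \<phi> (Suc \<mu> mod N) - \<phi> (\<mu> mod N))"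
    by (intro sum.cong) auto
  also have "\<dots> = \<phi> 0 - \<phi> 1"
    using assms sum_Suc_diff[of 1 "N - 1" "\<lambda>\<mu>. \<phi> (\<mu> mod N)"] by simp
  finally have t: "total_angle N \<phi> = \<phi> 0 - \<phi> 1 + 2 * pi * of_int (\<Sum>\<mu> = 1..N - 1. K (?x \<mu>))" .
  show ?thesis unfolding t cos_add cos_int_2pin sin_int_2pin by simp
qed

text \<open>The product of spins 0 and 1 is the cosine of the total angle, and the sign convention
  then fixes its sine. So a product common to all minimizers makes the definite description well
  defined, with \<open>s\<close> as witness.\<close>

lemma lagrange_param_eq:
  assumes N: "N > 1"
    and C: "\<And>t. is_LEC N (\<alpha>(0 := a)) t \<Longrightarrow> t 0 \<bullet> t 1 = C"
    and s: "is_LEC N (\<alpha>(0 := a)) s" "planar_angles N s \<phi>" "sin (total_angle N \<phi>) \<ge> 0"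
  shows "lagrange_param N \<alpha> a = a * sqrt (1 - C\<^sup>2)"
proof -
  have sin: "sin (total_angle N \<psi>) = sqrt (1 - C\<^sup>2)"
    if t: "is_LEC N (\<alpha>(0 := a)) t" "planar_angles N t \<psi>" "sin (total_angle N \<psi>) \<ge> 0" for t \<psi>
  proof -
    have "cos (total_angle N \<psi>) = C"
      using cos_total_angle[OF N] planar_angles_inner[OF t(2), of 0 1] C[OF t(1)] N by simp
    moreover have "\<bar>sin (total_angle N \<psi>)\<bar> = sqrt (1 - (cos (total_angle N \<psi>))\<^sup>2)"
      by (simp add: sin_squared_eq[symmetric])
    ultimately show ?thesis using t(3) by simp
  qed
  show ?thesis unfolding lagrange_param_def
  proof (rule the_equality)
    show "is_lagrange_param N (\<alpha>(0 := a)) (a * sqrt (1 - C\<^sup>2))"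
      unfolding is_lagrange_param_def using s sin[OF s] by (intro exI[of _ s] exI[of _ \<phi>]) simp
    show "b = a * sqrt (1 - C\<^sup>2)" if "is_lagrange_param N (\<alpha>(0 := a)) b" for b
      using that sin unfolding is_lagrange_param_def by auto
  qed
qed

definition planar_config :: "(nat \<Rightarrow> real) \<Rightarrow> nat \<Rightarrow> real ^ 3" where
  "planar_config \<phi> k = cos (\<phi> k) *\<^sub>R axis 1 1 + sin (\<phi> k) *\<^sub>R axis 2 1"

lemma planar_angles_planar_config: "planar_angles N (planar_config \<phi>) \<phi>"
  unfolding planar_angles_def planar_config_def
  by (intro exI[of _ "axis 1 1"] exI[of _ "axis 2 1"]) (simp add: inner_axis_axis)

lemma planar_config_inner: "planar_config \<phi> j \<bullet> planar_config \<phi> k = cos (\<phi> j - \<phi> k)"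
  using planar_angles_inner[OF planar_angles_planar_config[of "Suc (max j k)" \<phi>], of j k] by simp

lemma spin_config_planar_config: "spin_config N (planar_config \<phi>)"
  unfolding spin_config_def using planar_config_inner[of \<phi>] by (simp add: norm_eq_1)

lemma spin_config_inner_self: "spin_config N s \<Longrightarrow> k < N \<Longrightarrow> s k \<bullet> s k = 1"
  by (simp add: spin_config_def dot_square_norm)

section \<open>Critical angles are global minimizers\<close>

locale spin_family =
  fixes N :: nat and \<alpha> :: "nat \<Rightarrow> real"
  assumes N: "N > 2"
    and neg: "k \<in> {1..N - 1} \<Longrightarrow> \<alpha> k < 0"
begin

lemma energy_eq:
  "energy N (\<alpha>(0 := a)) s = a * (s 0 \<bullet> s 1) - (\<Sum>k = 1..N - 1. \<bar>\<alpha> k\<bar> * (s k \<bullet> s (Suc k mod N)))"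
proof -
  have "{..<N} = insert 0 {1..N - 1}" using N by auto
  then have "energy N (\<alpha>(0 := a)) s
      = a * (s 0 \<bullet> s 1) + (\<Sum>k = 1..N - 1. (\<alpha>(0 := a)) k * (s k \<bullet> s (Suc k mod N)))"
    using N by (simp add: energy_def)
  also have "(\<Sum>k = 1..N - 1. (\<alpha>(0 := a)) k * (s k \<bullet> s (Suc k mod N)))
      = (\<Sum>k = 1..N - 1. - (\<bar>\<alpha> k\<bar> * (s k \<bullet> s (Suc k mod N))))"
    using neg by (intro sum.cong) (auto simp: abs_of_neg)
  finally show ?thesis by (simp only: sum_negf diff_conv_add_uminus)
qed

text \<open>The Lagrange condition, with Lagrange parameter \<open>\<beta> = a sin \<Psi>\<close>.\<close>

definition critical :: "real \<Rightarrow> (nat \<Rightarrow> real) \<Rightarrow> bool" where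
  "critical a \<theta> \<longleftrightarrow> sum \<theta> {1..N - 1} < pi \<and>
     (\<forall>k \<in> {1..N - 1}. 0 < \<theta> k \<and> \<bar>\<alpha> k\<bar> * sin (\<theta> k) = a * sin (sum \<theta> {1..N - 1}))"

lemma critical_bounds:
  assumes "critical a \<theta>"
  shows "0 < sum \<theta> {1..N - 1}" "sum \<theta> {1..N - 1} < pi" "0 < sin (sum \<theta> {1..N - 1})"
    "k \<in> {1..N - 1} \<Longrightarrow> 0 < \<theta> k" "k \<in> {1..N - 1} \<Longrightarrow> \<theta> k < pi" "k \<in> {1..N - 1} \<Longrightarrow> 0 < sin (\<theta> k)"
    "k \<in> {1..N - 1} \<Longrightarrow> sum \<theta> {1..k} < pi" "k \<in> {1..N - 1} \<Longrightarrow> 0 < sin (sum \<theta> {1..k})"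
    "k \<in> {1..N - 1} \<Longrightarrow> \<bar>\<alpha> k\<bar> * sin (\<theta> k) = a * sin (sum \<theta> {1..N - 1})"
proof -
  show pos: "k \<in> {1..N - 1} \<Longrightarrow> 0 < \<theta> k" for k using assms by (auto simp: critical_def)
  show P: "sum \<theta> {1..N - 1} < pi" using assms by (simp add: critical_def)
  show P0: "0 < sum \<theta> {1..N - 1}" using N pos by (intro sum_pos) auto
  show "0 < sin (sum \<theta> {1..N - 1})" using P0 P by (rule sin_gt_zero)
  show eq: "k \<in> {1..N - 1} \<Longrightarrow> \<bar>\<alpha> k\<bar> * sin (\<theta> k) = a * sin (sum \<theta> {1..N - 1})"
    using assms by (simp add: critical_def)
  show k: "sum \<theta> {1..k} < pi" if "k \<in> {1..N - 1}" for k
    using that pos sum_mono2[of "{1..N - 1}" "{1..k}" \<theta>] P by (fastforce intro: less_imp_le)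
  show "0 < sin (sum \<theta> {1..k})" if "k \<in> {1..N - 1}" for k
    using k[OF that] that pos by (intro sin_gt_zero sum_pos) auto
  show "\<theta> k < pi" if "k \<in> {1..N - 1}" for k
    using that pos sum_mono2[of "{1..N - 1}" "{k}" \<theta>] P by (fastforce intro: less_imp_le)
  then show "k \<in> {1..N - 1} \<Longrightarrow> 0 < sin (\<theta> k)" using pos by (auto intro: sin_gt_zero)
qed

text \<open>The energy excess over the critical energy divided by the Lagrange parameter, see
  \<open>energy_defect\<close>. Bond 0 enters with the opposite sign, as a single step of angle
  \<open>sum \<theta> {1..N - 1}\<close>.\<close>

definition defect :: "(nat \<Rightarrow> real) \<Rightarrow> (nat \<Rightarrow> real ^ 3) \<Rightarrow> real" where
  "defect \<theta> s = (\<Sum>k = 1..N - 1. (cos (\<theta> k) - s k \<bullet> s (Suc k mod N)) / sin (\<theta> k))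
     - (cos (sum \<theta> {1..N - 1}) - s 0 \<bullet> s 1) / sin (sum \<theta> {1..N - 1})"

text \<open>The Lagrange condition lets each weight \<open>\<bar>\<alpha> k\<bar>\<close> be written
  as the common factor \<open>a * sin (sum \<theta> {1..N - 1})\<close> over
  \<open>sin (\<theta> k)\<close>.\<close>

lemma energy_defect:
  assumes "critical a \<theta>"
  shows "energy N (\<alpha>(0 := a)) s = a * cos (sum \<theta> {1..N - 1})
    - (\<Sum>k = 1..N - 1. \<bar>\<alpha> k\<bar> * cos (\<theta> k)) + a * sin (sum \<theta> {1..N - 1}) * defect \<theta> s"
proof -
  note b = critical_bounds[OF assms]
  let ?P = "sum \<theta> {1..N - 1}"
  have "a * sin ?P * (\<Sum>k = 1..N - 1. (cos (\<theta> k) - s k \<bullet> s (Suc k mod N)) / sin (\<theta> k))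
     = (\<Sum>k = 1..N - 1. \<bar>\<alpha> k\<bar> * (cos (\<theta> k) - s k \<bullet> s (Suc k mod N)))"
    unfolding sum_distrib_left
  proof (intro sum.cong refl)
    fix k assume k: "k \<in> {1..N - 1}"
    show "a * sin ?P * ((cos (\<theta> k) - s k \<bullet> s (Suc k mod N)) / sin (\<theta> k))
      = \<bar>\<alpha> k\<bar> * (cos (\<theta> k) - s k \<bullet> s (Suc k mod N))"
      unfolding b(9)[OF k, symmetric] using b(6)[OF k] by simp
  qed
  moreover have "a * sin ?P * ((cos ?P - s 0 \<bullet> s 1) / sin ?P) = a * (cos ?P - s 0 \<bullet> s 1)"
    using b(3) by simp
  ultimately show ?thesis unfolding energy_eq defect_def right_diff_distrib[of "a * sin ?P"]
    by (simp add: right_diff_distrib sum_subtractf)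
qed

lemma defect_nonneg:
  assumes "critical a \<theta>" "spin_config N s"
  shows "0 \<le> defect \<theta> s"
    and "defect \<theta> s = 0 \<Longrightarrow> k \<in> {2..N - 1} \<Longrightarrow>
      sin (sum \<theta> {1..k}) *\<^sub>R s k = sin (\<theta> k) *\<^sub>R s 1 + sin (sum \<theta> {1..k - 1}) *\<^sub>R s (Suc k mod N)"
proof -
  note b = critical_bounds[OF assms(1)]
  \<comment> \<open>The polygon is cut open at bond 0 into a chain from spin 1 to spin 0; the
    reduction modulo \<open>N\<close> makes \<open>?p N\<close> spin 0.\<close>
  let ?p = "\<lambda>k. s (k mod N)"
  have "(\<Sum>k = 1..N - 1. (cos (\<theta> k) - s k \<bullet> s (Suc k mod N)) / sin (\<theta> k))
      = (\<Sum>k = 1..N - 1. (cos (\<theta> k) - ?p k \<bullet> ?p (Suc k)) / sin (\<theta> k))"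
    by (intro sum.cong) auto
  then have d: "defect \<theta> s = (\<Sum>k = 1..N - 1. (cos (\<theta> k) - ?p k \<bullet> ?p (Suc k)) / sin (\<theta> k))
       - (cos (sum \<theta> {1..N - 1}) - ?p 1 \<bullet> ?p (Suc (N - 1))) / sin (sum \<theta> {1..N - 1})"
    unfolding defect_def using N by (simp add: inner_commute)
  have "\<And>k. norm (?p k) = 1" using assms(2) N by (simp add: spin_config_def)
  then have *: "0 \<le> defect \<theta> s \<and> (defect \<theta> s = 0 \<longrightarrow> (\<forall>k \<in> {2..N - 1}.
    sin (sum \<theta> {1..k}) *\<^sub>R ?p k = sin (\<theta> k) *\<^sub>R ?p 1 + sin (sum \<theta> {1..k - 1}) *\<^sub>R ?p (Suc k)))"
    unfolding d using b N by (intro unit_chain_defect) auto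
  then show "0 \<le> defect \<theta> s" by blast
  assume "defect \<theta> s = 0" and k: "k \<in> {2..N - 1}"
  then have "sin (sum \<theta> {1..k}) *\<^sub>R ?p k = sin (\<theta> k) *\<^sub>R ?p 1 + sin (sum \<theta> {1..k - 1}) *\<^sub>R ?p (Suc k)"
    using * by blast
  moreover have "k < N" using k N by auto
  ultimately show "sin (sum \<theta> {1..k}) *\<^sub>R s k = sin (\<theta> k) *\<^sub>R s 1 + sin (sum \<theta> {1..k - 1}) *\<^sub>R s (Suc k mod N)"
    using N by simp
qed

text \<open>Spin 1 lies at angle 0. Spin 0 is the end of the chain and so carries the full
  sum.\<close>

definition angles_of :: "(nat \<Rightarrow> real) \<Rightarrow> nat \<Rightarrow> real" where
  "angles_of \<theta> k = (if k = 0 then sum \<theta> {1..N - 1} else sum \<theta> {1..<k})"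

lemma angles_of_step: "k \<in> {1..N - 1} \<Longrightarrow> angles_of \<theta> (Suc k mod N) - angles_of \<theta> k = \<theta> k"
proof -
  assume k: "k \<in> {1..N - 1}"
  have *: "sum \<theta> {1..<Suc k} = sum \<theta> {1..<k} + \<theta> k" using k by (simp add: sum.atLeastLessThan_Suc)
  show ?thesis
  proof (cases "Suc k = N")
    case True
    then have "{1..N - 1} = {1..<Suc k}" by auto
    then show ?thesis using True k * by (simp add: angles_of_def)
  next
    case False
    then have "Suc k mod N = Suc k" using k by auto
    then show ?thesis using k * by (simp add: angles_of_def)
  qed
qed

lemma planar_config_critical:
  assumes c: "critical a \<theta>" and a: "a > 0"
  shows "defect \<theta> (planar_config (angles_of \<theta>)) = 0"
    and "is_LEC N (\<alpha>(0 := a)) (planar_config (angles_of \<theta>))"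
    and "total_angle N (angles_of \<theta>) = sum \<theta> {1..N - 1}"
proof -
  let ?s = "planar_config (angles_of \<theta>)"
  note b = critical_bounds[OF c]
  have "?s k \<bullet> ?s (Suc k mod N) = cos (\<theta> k)" if "k \<in> {1..N - 1}" for k
    using angles_of_step[OF that, of \<theta>] cos_minus[of "angles_of \<theta> k - angles_of \<theta> (Suc k mod N)"]
    by (simp add: planar_config_inner)
  moreover have "?s 0 \<bullet> ?s 1 = cos (sum \<theta> {1..N - 1})"
    by (simp add: planar_config_inner angles_of_def)
  ultimately show d: "defect \<theta> ?s = 0" by (simp add: defect_def)
  show "is_LEC N (\<alpha>(0 := a)) ?s"
    unfolding is_LEC_def using spin_config_planar_config defect_nonneg(1)[OF c] a b(3)
    by (auto simp: energy_defect[OF c] d)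
  have "principal_angle (angles_of \<theta> (Suc k mod N) - angles_of \<theta> k) = \<theta> k" if k: "k \<in> {1..N - 1}" for k
    unfolding angles_of_step[OF k] principal_angle_unique using b(4,5)[OF k] by (auto intro!: exI[of _ 0])
  then show "total_angle N (angles_of \<theta>) = sum \<theta> {1..N - 1}"
    unfolding total_angle_def by (intro sum.cong) auto
qed

text \<open>Comparison with the planar minimizer forces zero defect, hence the interpolation
  relations of \<open>defect_nonneg\<close>. The last of them determines the product of spins 0 and
  1; all together they confine the spins to a plane.\<close>

lemma LEC_critical:
  assumes c: "critical a \<theta>" and a: "a > 0" and t: "is_LEC N (\<alpha>(0 := a)) t"
  shows "t 0 \<bullet> t 1 = cos (sum \<theta> {1..N - 1})" and "coplanar_config N t"
proof -
  note b = critical_bounds[OF c]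
  let ?P = "sum \<theta> {1..N - 1}"
  have tc: "spin_config N t" using t by (simp add: is_LEC_def)
  have "energy N (\<alpha>(0 := a)) t \<le> energy N (\<alpha>(0 := a)) (planar_config (angles_of \<theta>))"
    using t spin_config_planar_config by (auto simp: is_LEC_def)
  then have "a * sin ?P * defect \<theta> t \<le> 0"
    unfolding energy_defect[OF c] planar_config_critical(1)[OF c a] by simp
  then have d: "defect \<theta> t = 0"
    using a b(3) defect_nonneg(1)[OF c tc] by (simp add: mult_le_0_iff)
  have id: "sin (sum \<theta> {1..k}) *\<^sub>R t k = sin (\<theta> k) *\<^sub>R t 1 + sin (sum \<theta> {1..k - 1}) *\<^sub>R t (Suc k mod N)"
    if "k \<in> {2..N - 1}" for k using defect_nonneg(2)[OF c tc d that] .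
  show dot: "t 0 \<bullet> t 1 = cos ?P"
  proof -
    let ?A = "sum \<theta> {1..N - 2}" and ?B = "\<theta> (N - 1)"
    have P: "?P = ?A + ?B" using N by (simp add: numeral_2_eq_2 sum.nat_ivl_Suc' flip: Suc_diff_Suc)
    have sA: "0 < sin ?A" "0 < sin ?B" 
    proof -
      have "N - 2 \<in> {1..N - 1}" "N - 1 \<in> {1..N - 1}" using N by auto
      then show "0 < sin ?A" "0 < sin ?B" using b(6,8) by blast+
    qed
    \<comment> \<open>Relation for \<open>k = N - 1\<close>, with successor index 0. Its squared
      norm determines \<open>t 0 \<bullet> t 1\<close>, whose coefficient
      \<open>2 * sin ?A * sin ?B\<close> is nonzero.\<close>
    have i: "sin ?P *\<^sub>R t (N - 1) = sin ?B *\<^sub>R t 1 + sin ?A *\<^sub>R t 0"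
      using id[of "N - 1"] N by (simp add: numeral_2_eq_2 diff_diff_left)
    have "(sin ?P)\<^sup>2 = (sin ?P *\<^sub>R t (N - 1)) \<bullet> (sin ?P *\<^sub>R t (N - 1))"
      using spin_config_inner_self[OF tc, of "N - 1"] N by (simp add: power2_eq_square)
    also have "\<dots> = (sin ?A)\<^sup>2 + (sin ?B)\<^sup>2 + 2 * sin ?A * sin ?B * (t 0 \<bullet> t 1)"
      unfolding i using spin_config_inner_self[OF tc, of 0] spin_config_inner_self[OF tc, of 1] N
      by (simp add: inner_add_left inner_add_right inner_commute power2_eq_square algebra_simps)
    finally have 1: "(sin ?P)\<^sup>2 = (sin ?A)\<^sup>2 + (sin ?B)\<^sup>2 + 2 * sin ?A * sin ?B * (t 0 \<bullet> t 1)" .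
    have "(sin ?P)\<^sup>2 = (sin ?A)\<^sup>2 + (sin ?B)\<^sup>2 + 2 * sin ?A * sin ?B * cos ?P"
    proof -
      have "sin ?A = sin ?P * cos ?B - cos ?P * sin ?B" "sin ?B = sin ?P * cos ?A - cos ?P * sin ?A"
        using sin_diff[of ?P ?B] sin_diff[of ?P ?A] unfolding P by simp_all
      moreover have "sin ?P = sin ?A * cos ?B + cos ?A * sin ?B" by (simp only: P sin_add)
      ultimately show ?thesis by algebra
    qed
    with 1 show ?thesis using sA by simp
  qed
  \<comment> \<open>The range includes \<open>k = N\<close>, through which spin 0 is
    reached.\<close>
  have in_span: "t (k mod N) \<in> span {t 1, t 2}" if "1 \<le> k" "k \<le> N" for k
    using that
  proof (induction k rule: dec_induct)
    case base
    then show ?case using N by (simp add: span_base)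
  next
    case (step k)
    show ?case
    \<comment> \<open>For \<open>k > 1\<close> the relation at \<open>k\<close> is solved for the
      next spin; at \<open>k = 1\<close> the coefficient to divide by would be the sine of an empty
      sum.\<close>
    proof (cases "k = 1")
      case True
      then show ?thesis using N by (simp add: span_base numeral_2_eq_2)
    next
      case False
      then have k: "k \<in> {2..N - 1}" "k - 1 \<in> {1..N - 1}" "k < N" using step by auto
      let ?S = "sin (sum \<theta> {1..k - 1})"
      have S: "?S > 0" using b(8) k by blast
      have "t (Suc k mod N) = inverse ?S *\<^sub>R (?S *\<^sub>R t (Suc k mod N))" using S by simp
      also have "\<dots> = inverse ?S *\<^sub>R (sin (sum \<theta> {1..k}) *\<^sub>R t k - sin (\<theta> k) *\<^sub>R t 1)"
        using id[OF k(1)] by (simp add: algebra_simps)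
      also have "\<dots> \<in> span {t 1, t 2}"
        using step k(3) by (intro span_scale span_diff) (auto simp: span_base)
      finally show ?thesis .
    qed
  qed
  have "t ` {..<N} \<subseteq> span {t 1, t 2}"
  proof
    fix x assume "x \<in> t ` {..<N}"
    then obtain k where k: "k < N" "x = t k" by auto
    then show "x \<in> span {t 1, t 2}" using in_span[of k] in_span[of N] N by (cases "k = 0") auto
  qed
  then have "dim (t ` {..<N}) \<le> card {t 1, t 2}" by (intro dim_le_card) auto
  also have "\<dots> \<le> 2" by (simp add: card_insert_if)
  finally have le: "dim (t ` {..<N}) \<le> 2" .
  have n: "norm (t 0) = 1" "norm (t 1) = 1" using tc N by (auto simp: spin_config_def)
  \<comment> \<open>Spins 0 and 1 are not parallel, which excludes dimension 1.\<close>
  have "(cos ?P)\<^sup>2 \<noteq> 1" 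
  proof
    assume "(cos ?P)\<^sup>2 = 1"
    then have "(sin ?P)\<^sup>2 = 0" by (simp add: sin_squared_eq)
    then show False using b(3) by simp
  qed
  then have "\<bar>cos ?P\<bar> \<noteq> 1" by (simp add: abs_square_eq_1)
  then have ne: "\<bar>t 0 \<bullet> t 1\<bar> \<noteq> 1" using dot by simp
  have "t 0 \<notin> span {t 1}"
  proof
    assume "t 0 \<in> span {t 1}"
    then obtain c where "t 0 = c *\<^sub>R t 1" by (auto simp: span_singleton)
    then show False using ne n by (auto simp: dot_square_norm)
  qed
  then have "independent {t 0, t 1}" "t 0 \<noteq> t 1"
    using n by (auto simp: independent_insert span_base)
  then have "dim {t 0, t 1} = 2" by (simp add: dim_eq_card_independent)
  moreover have "dim {t 0, t 1} \<le> dim (t ` {..<N})" using N by (intro dim_subset) auto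
  ultimately show "coplanar_config N t" using le by (simp add: coplanar_config_def)
qed

end

section \<open>Collinear minimizers\<close>

lemma sum_mod_shift:
  fixes u :: "nat \<Rightarrow> 'a::ab_group_add"
  assumes "N > 0"
  shows "(\<Sum>k<N. u (Suc k mod N) - u k) = 0"
proof -
  have "(\<Sum>k<N. u (Suc k mod N) - u k) = (\<Sum>k<N. u (Suc k mod N) - u (k mod N))"
    by (intro sum.cong) auto
  also have "\<dots> = 0" using sum_lessThan_telescope[of "\<lambda>k. u (k mod N)" N] by simp
  finally show ?thesis .
qed

lemma norm_diff_unit:
  fixes x y :: "'a::real_inner"
  assumes "norm x = 1" "norm y = 1"
  shows "(norm (x - y))\<^sup>2 = 2 - 2 * (x \<bullet> y)"
proof -
  have "x \<bullet> x = 1" "y \<bullet> y = 1" using assms by (simp_all add: dot_square_norm)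
  then show ?thesis
    unfolding power2_norm_eq_inner by (simp add: inner_diff_left inner_diff_right inner_commute)
qed

text \<open>A line meets a sphere in at most two points, whereas the parameters 0, \<open>r\<close>
  and \<open>r + q\<close> are distinct.\<close>

lemma unit_vectors_on_line:
  fixes x D :: "'a::real_inner"
  assumes "norm x = 1" "norm (x + r *\<^sub>R D) = 1" "norm (x + (r + q) *\<^sub>R D) = 1" "r > 0" "q > 0"
  shows "D = 0"
proof -
  have e: "s * (2 * (x \<bullet> D) + s * (D \<bullet> D)) = 0" if "norm (x + s *\<^sub>R D) = 1" for s
  proof -
    have "(x + s *\<^sub>R D) \<bullet> (x + s *\<^sub>R D) = 1" "x \<bullet> x = 1"
      using that assms(1) by (simp_all add: dot_square_norm)
    then show ?thesis by (simp add: inner_add_left inner_add_right inner_commute algebra_simps)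
  qed
  have "2 * (x \<bullet> D) + r * (D \<bullet> D) = 0" "2 * (x \<bullet> D) + (r + q) * (D \<bullet> D) = 0"
    using e[OF assms(2)] e[OF assms(3)] assms(4,5) by auto
  then have "q * (D \<bullet> D) = 0" by (simp add: algebra_simps)
  then show ?thesis using assms(5) by simp
qed

text \<open>Side \<open>e\<close> is minus the sum \<open>D\<close> of the others, so the bound is
  the series-spring inequality with \<open>w e \<le> 1 / R\<close>. In the equality case all other
  sides are positive multiples of \<open>D\<close>.\<close>

lemma closed_polygon:
  fixes u :: "nat \<Rightarrow> 'a::real_inner"
  assumes N: "N > 2" and e: "e < N"
    and w: "\<And>k. k \<in> {..<N} - {e} \<Longrightarrow> 0 < w k"
    and we: "w e * (\<Sum>k\<in>{..<N} - {e}. inverse (w k)) \<le> 1"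
  defines "d \<equiv> \<lambda>k. u (Suc k mod N) - u k"
  shows "w e * (norm (d e))\<^sup>2 \<le> (\<Sum>k\<in>{..<N} - {e}. w k * (norm (d k))\<^sup>2)"
    and "(\<Sum>k\<in>{..<N} - {e}. w k * (norm (d k))\<^sup>2) \<le> w e * (norm (d e))\<^sup>2 \<Longrightarrow>
      (\<And>k. k < N \<Longrightarrow> norm (u k) = 1) \<Longrightarrow> j < N \<Longrightarrow> u j = u 0"
proof -
  let ?K = "{..<N} - {e}"
  define R where "R = (\<Sum>k\<in>?K. inverse (w k))"
  define D where "D = (\<Sum>k\<in>?K. d k)"
  define Q where "Q = (\<Sum>k\<in>?K. w k * (norm (d k - (inverse (w k) / R) *\<^sub>R D))\<^sup>2)"
  have ne: "?K \<noteq> {}"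
  proof -
    have "0 \<in> ?K \<or> 1 \<in> ?K" using N by auto
    then show ?thesis by blast
  qed
  have R: "R > 0" unfolding R_def using w ne by (intro sum_pos) auto
  have Q: "Q \<ge> 0" unfolding Q_def using w by (auto intro!: sum_nonneg mult_nonneg_nonneg intro: less_imp_le)
  have id: "(\<Sum>k\<in>?K. w k * (norm (d k))\<^sup>2) = (norm D)\<^sup>2 / R + Q"
    unfolding Q_def R_def D_def using w ne by (intro sum_weighted_norm_square) auto
  have "d e + D = 0"
    using sum_mod_shift[of N u] N e sum.remove[of "{..<N}" e d] by (simp add: D_def d_def)
  then have nD: "norm (d e) = norm D" using norm_minus_cancel[of D] by (simp add: add_eq_0_iff2)
  have "w e \<le> 1 / R" using we R by (simp add: R_def field_simps)
  then have le: "w e * (norm (d e))\<^sup>2 \<le> (norm D)\<^sup>2 / R"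
    using mult_right_mono[of "w e" "1 / R" "(norm D)\<^sup>2"] unfolding nD by simp
  then show "w e * (norm (d e))\<^sup>2 \<le> (\<Sum>k\<in>?K. w k * (norm (d k))\<^sup>2)" using id Q by linarith
  assume "(\<Sum>k\<in>?K. w k * (norm (d k))\<^sup>2) \<le> w e * (norm (d e))\<^sup>2"
    and u: "\<And>k. k < N \<Longrightarrow> norm (u k) = 1" and j: "j < N"
  then have "Q = 0" using id le Q by linarith
  then have "\<forall>k\<in>?K. w k * (norm (d k - (inverse (w k) / R) *\<^sub>R D))\<^sup>2 = 0"
    unfolding Q_def using w by (subst (asm) sum_nonneg_eq_0_iff) (auto intro!: mult_nonneg_nonneg intro: less_imp_le)
  note * = this
  have dk: "d k = (inverse (w k) / R) *\<^sub>R D" if "k \<in> ?K" for k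
  proof -
    have "w k * (norm (d k - (inverse (w k) / R) *\<^sub>R D))\<^sup>2 = 0" "w k \<noteq> 0"
      using bspec[OF * that] w[OF that] by simp_all
    then show ?thesis by simp
  qed
  \<comment> \<open>The two sides after side \<open>e\<close>; both differ from it as
    \<open>N > 2\<close>. They put three successive unit vectors on one line, so
    \<open>D = 0\<close>.\<close>
  let ?i = "Suc e mod N" and ?j = "Suc (Suc e) mod N"
  have ij: "?i \<in> ?K" "?j \<in> ?K" "Suc ?i mod N = ?j"
    using e N by (auto simp: mod_Suc)
  have "D = 0"
  proof (rule unit_vectors_on_line)
    have *: "u ?j = u ?i + (inverse (w ?i) / R) *\<^sub>R D"
      using dk[OF ij(1)] ij(3) by (simp add: d_def algebra_simps)
    have "u (Suc ?j mod N) = u ?j + (inverse (w ?j) / R) *\<^sub>R D"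
      using dk[OF ij(2)] by (simp add: d_def algebra_simps)
    then have **: "u (Suc ?j mod N) = u ?i + (inverse (w ?i) / R + inverse (w ?j) / R) *\<^sub>R D"
      by (simp add: * algebra_simps)
    show "norm (u ?i) = 1" "norm (u ?i + (inverse (w ?i) / R) *\<^sub>R D) = 1"
      "norm (u ?i + (inverse (w ?i) / R + inverse (w ?j) / R) *\<^sub>R D) = 1"
      using u N unfolding *[symmetric] **[symmetric] by auto
    show "0 < inverse (w ?i) / R" "0 < inverse (w ?j) / R" using w ij R by auto
  qed
  then have d0: "d k = 0" if "k < N" for k
    using dk[of k] nD that by (cases "k = e") auto
  show "u j = u 0" using j
  proof (induction j)
    case (Suc j)
    then show ?case using d0[of j] by (simp add: d_def)
  qed simp
qed

lemma energy_unit: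
  assumes "spin_config N s" "N > 0"
  shows "energy N b s = (\<Sum>k<N. b k) - (\<Sum>k<N. b k * (norm (s (Suc k mod N) - s k))\<^sup>2) / 2"
proof -
  have "b k * (s k \<bullet> s (Suc k mod N)) = b k - b k * (norm (s (Suc k mod N) - s k))\<^sup>2 / 2" if "k < N" for k
  proof -
    have "(norm (s (Suc k mod N) - s k))\<^sup>2 = 2 - 2 * (s k \<bullet> s (Suc k mod N))"
      using norm_diff_unit[of "s (Suc k mod N)" "s k"] assms that
      by (simp add: spin_config_def inner_commute)
    then show ?thesis by (simp only:) (simp add: right_diff_distrib diff_divide_distrib)
  qed
  then show ?thesis by (simp add: energy_def sum_subtractf sum_divide_distrib)
qed

lemma weak_bond_LEC:
  assumes N: "N > 2" and e: "e < N"
    and neg: "\<And>k. k \<in> {..<N} - {e} \<Longrightarrow> b k < 0"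
    and be: "b e * (\<Sum>k\<in>{..<N} - {e}. inverse \<bar>b k\<bar>) \<le> 1"
  shows "norm v = 1 \<Longrightarrow> is_LEC N b (\<lambda>_. v)"
    and "is_LEC N b t \<Longrightarrow> k < N \<Longrightarrow> t k = t 0"
proof -
  \<comment> \<open>With these signs the energy is a constant plus half the difference of the two
    sides of the inequality in \<open>closed_polygon\<close>, and constant configurations make that
    difference zero.\<close>
  define w where "w k = (if k = e then b e else - b k)" for k
  let ?K = "{..<N} - {e}"
  let ?d = "\<lambda>s k. s (Suc k mod N) - s k :: real ^ 3"
  have split: "(\<Sum>k<N. b k * (norm (?d s k))\<^sup>2) = w e * (norm (?d s e))\<^sup>2 - (\<Sum>k\<in>?K. w k * (norm (?d s k))\<^sup>2)" for s
    using e by (simp add: sum.remove[of "{..<N}" e] w_def sum_negf)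
  have w: "0 < w k" if "k \<in> ?K" for k using neg[OF that] that by (auto simp: w_def)
  have "(\<Sum>k\<in>?K. inverse (w k)) = (\<Sum>k\<in>?K. inverse \<bar>b k\<bar>)"
    using neg by (intro sum.cong) (auto simp: w_def abs_of_neg)
  then have we: "w e * (\<Sum>k\<in>?K. inverse (w k)) \<le> 1" using be by (simp add: w_def)
  have *: "w e * (norm (?d s e))\<^sup>2 \<le> (\<Sum>k\<in>?K. w k * (norm (?d s k))\<^sup>2)" for s
    using closed_polygon(1)[where u = s, OF N e w we] .
  have en: "energy N b s = (\<Sum>k<N. b k)
      - (w e * (norm (?d s e))\<^sup>2 - (\<Sum>k\<in>?K. w k * (norm (?d s k))\<^sup>2)) / 2" if "spin_config N s" for s
    using energy_unit[OF that, of b] N unfolding split by simp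
  have const: "spin_config N (\<lambda>_. v)" "energy N b (\<lambda>_. v) = (\<Sum>k<N. b k)" if "norm v = 1" for v
  proof -
    show "spin_config N (\<lambda>_. v)" using that by (simp add: spin_config_def)
    then show "energy N b (\<lambda>_. v) = (\<Sum>k<N. b k)" by (subst en) auto
  qed
  show "is_LEC N b (\<lambda>_. v)" if "norm v = 1"
    unfolding is_LEC_def using const[OF that] en * by simp
  assume t: "is_LEC N b t" and k: "k < N"
  then have tc: "spin_config N t" by (simp add: is_LEC_def)
  have "norm (axis 1 1 :: real ^ 3) = 1" by simp
  from const[OF this] have "energy N b t \<le> (\<Sum>k<N. b k)" using t by (auto simp: is_LEC_def)
  then have le: "(\<Sum>k\<in>?K. w k * (norm (?d t k))\<^sup>2) \<le> w e * (norm (?d t e))\<^sup>2"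
    unfolding en[OF tc] by simp
  have unit: "norm (t k) = 1" if "k < N" for k using tc that by (simp add: spin_config_def)
  show "t k = t 0" by (rule closed_polygon(2)[where u = t, OF N e w we le unit k])
qed

lemma collinear_config_signs:
  assumes "N > 0" "spin_config N s" "\<And>k. k < N \<Longrightarrow> s k = v \<or> s k = - v"
  shows "collinear_config N s"
proof -
  have "norm (s 0) = 1" using assms(1,2) by (simp add: spin_config_def)
  then have "s 0 \<noteq> 0" by auto
  have "s ` {..<N} \<subseteq> span {v}"
  proof
    fix x assume "x \<in> s ` {..<N}"
    then have "x = v \<or> x = - v" using assms(3) by auto
    then show "x \<in> span {v}" by (auto intro: span_base span_neg)
  qed
  then have "dim (s ` {..<N}) \<le> card {v}" by (intro dim_le_card) auto
  moreover have "dim {s 0} \<le> dim (s ` {..<N})" using assms(1) by (intro dim_subset) auto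
  moreover have "independent {s 0}" using \<open>s 0 \<noteq> 0\<close> by simp
  then have "dim {s 0} = 1" by (simp add: dim_eq_card_independent)
  ultimately show ?thesis by (simp add: collinear_config_def)
qed

section \<open>Collinear minimizers of the family, with bond 0 or bond \<open>\<tau>\<close> as the
  weak bond\<close>

context spin_family
begin

lemma flat_LEC:
  assumes a: "a > 0" "a * (\<Sum>k = 1..N - 1. inverse \<bar>\<alpha> k\<bar>) \<le> 1"
  shows "norm v = 1 \<Longrightarrow> is_LEC N (\<alpha>(0 := a)) (\<lambda>_. v)"
    and "is_LEC N (\<alpha>(0 := a)) t \<Longrightarrow> k < N \<Longrightarrow> t k = t 0"
proof -
  have K: "{..<N} - {0} = {1..N - 1}" using N by auto
  have neg': "(\<alpha>(0 := a)) k < 0" if "k \<in> {..<N} - {0}" for k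
    using that neg[of k] unfolding K by simp
  have "(\<Sum>k\<in>{..<N} - {0}. inverse \<bar>(\<alpha>(0 := a)) k\<bar>) = (\<Sum>k = 1..N - 1. inverse \<bar>\<alpha> k\<bar>)"
    unfolding K by (intro sum.cong) auto
  then have "(\<alpha>(0 := a)) 0 * (\<Sum>k\<in>{..<N} - {0}. inverse \<bar>(\<alpha>(0 := a)) k\<bar>) \<le> 1" using a by simp
  note * = weak_bond_LEC[where b = "\<alpha>(0 := a)" and e = 0, OF N _ neg' this]
  show "norm v = 1 \<Longrightarrow> is_LEC N (\<alpha>(0 := a)) (\<lambda>_. v)" using *(1) N by simp
  show "is_LEC N (\<alpha>(0 := a)) t \<Longrightarrow> k < N \<Longrightarrow> t k = t 0" using *(2) N by simp
qed

lemma flat_types: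
  assumes a: "a > 0" "a * (\<Sum>k = 1..N - 1. inverse \<bar>\<alpha> k\<bar>) \<le> 1"
  shows "LEC_collinear N (\<alpha>(0 := a))" "\<not> LEC_coplanar N (\<alpha>(0 := a))" "lagrange_param N \<alpha> a = 0"
proof -
  note f = flat_LEC[OF a]
  show col: "LEC_collinear N (\<alpha>(0 := a))"
    unfolding LEC_collinear_def
  proof (intro allI impI)
    fix s assume s: "is_LEC N (\<alpha>(0 := a)) s"
    show "collinear_config N s"
    proof (rule collinear_config_signs)
      show "spin_config N s" using s by (simp add: is_LEC_def)
      show "s k = s 0 \<or> s k = - s 0" if "k < N" for k using f(2)[OF s that] by simp
    qed (use N in simp)
  qed
  \<comment> \<open>A concrete minimizer is needed both to refute coplanarity, which quantifies over
    all minimizers, and to evaluate the Lagrange parameter.\<close>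
  have LEC: "is_LEC N (\<alpha>(0 := a)) (planar_config (\<lambda>_. 0))"
    using f(1)[of "axis 1 1"] by (simp add: planar_config_def[abs_def])
  then show "\<not> LEC_coplanar N (\<alpha>(0 := a))"
    using col by (auto simp: LEC_collinear_def LEC_coplanar_def collinear_config_def coplanar_config_def)
  have dot: "t 0 \<bullet> t 1 = 1" if t: "is_LEC N (\<alpha>(0 := a)) t" for t
    using f(2)[OF t, of 1] N t spin_config_inner_self[of N t 0] by (simp add: is_LEC_def)
  have "principal_angle 0 = 0" unfolding principal_angle_unique by (auto intro: exI[of _ 0])
  then have "total_angle N (\<lambda>_. 0) = 0" by (simp add: total_angle_def)
  then show "lagrange_param N \<alpha> a = 0"
    using lagrange_param_eq[OF _ dot LEC planar_angles_planar_config] N by simp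
qed

lemma critical_types:
  assumes "critical a \<theta>" "a > 0"
  shows "LEC_coplanar N (\<alpha>(0 := a))" "\<not> LEC_collinear N (\<alpha>(0 := a))"
    and "lagrange_param N \<alpha> a = a * sin (sum \<theta> {1..N - 1})"
proof -
  note c = planar_config_critical[OF assms] and l = LEC_critical[OF assms]
  show "LEC_coplanar N (\<alpha>(0 := a))" using l(2) by (simp add: LEC_coplanar_def)
  then show "\<not> LEC_collinear N (\<alpha>(0 := a))"
    using c(2) by (auto simp: LEC_collinear_def LEC_coplanar_def collinear_config_def coplanar_config_def)
  have "0 < sin (sum \<theta> {1..N - 1})" using critical_bounds(3)[OF assms(1)] .
  moreover have "lagrange_param N \<alpha> a = a * sqrt (1 - (cos (sum \<theta> {1..N - 1}))\<^sup>2)"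
    using lagrange_param_eq[OF _ l(1) c(2) planar_angles_planar_config] N calculation c(3) by simp
  ultimately show "lagrange_param N \<alpha> a = a * sin (sum \<theta> {1..N - 1})"
    by (simp add: sin_squared_eq[symmetric])
qed

text \<open>Here the frustration sits at bond \<open>\<tau>\<close> instead of bond 0: the
  hypothesis is that of \<open>weak_bond_LEC\<close> with \<open>e = \<tau>\<close>, bond 0
  contributing \<open>inverse a\<close>. The minimizers consist of two opposite blocks of aligned
  spins.\<close>

lemma LEC_collinear_weak_bond:
  assumes \<tau>: "\<tau> \<in> {1..N - 1}" and a: "a > 0"
    and le: "\<bar>\<alpha> \<tau>\<bar> * (inverse a + (\<Sum>k\<in>{1..N - 1} - {\<tau>}. inverse \<bar>\<alpha> k\<bar>)) \<le> 1"
  shows "LEC_collinear N (\<alpha>(0 := a))"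
  unfolding LEC_collinear_def
proof (intro allI impI)
  fix t assume t: "is_LEC N (\<alpha>(0 := a)) t"
  \<comment> \<open>Reversing the spins outside \<open>{1..\<tau>}\<close> reverses the signs of the couplings \<open>0\<close> and \<open>\<tau>\<close> only,
    so that \<open>\<tau>\<close> becomes the positive bond.\<close>
  define b where "b = \<alpha>(0 := - a, \<tau> := \<bar>\<alpha> \<tau>\<bar>)"
  define flip :: "(nat \<Rightarrow> real ^ 3) \<Rightarrow> nat \<Rightarrow> real ^ 3"
    where "flip s k = (if k \<in> {1..\<tau>} then s k else - s k)" for s k
  have flip_flip: "flip (flip s) = s" for s by (auto simp: flip_def)
  have flip_config: "spin_config N (flip s)" if "spin_config N s" for s
    using that by (auto simp: spin_config_def flip_def)
  have \<tau>': "0 < \<tau>" "\<tau> < N" using \<tau> N by auto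
  have flip_energy: "energy N (\<alpha>(0 := a)) (flip s) = energy N b s" for s
    unfolding energy_def
  proof (intro sum.cong refl)
    fix k assume "k \<in> {..<N}"
    then have k: "k < N" by simp
    have "flip s k \<bullet> flip s (Suc k mod N) = (if k = 0 \<or> k = \<tau> then - 1 else 1) * (s k \<bullet> s (Suc k mod N))"
      using k \<tau>' N by (auto simp: flip_def mod_Suc)
    then show "(\<alpha>(0 := a)) k * (flip s k \<bullet> flip s (Suc k mod N)) = b k * (s k \<bullet> s (Suc k mod N))"
      using \<tau>' neg[OF \<tau>] by (auto simp: b_def)
  qed
  have lec: "is_LEC N b (flip t)"
    unfolding is_LEC_def
  proof (intro conjI allI impI)
    show "spin_config N (flip t)" using t flip_config by (simp add: is_LEC_def)
    fix s assume "spin_config N s"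
    then have "energy N (\<alpha>(0 := a)) t \<le> energy N (\<alpha>(0 := a)) (flip s)"
      using t flip_config by (simp add: is_LEC_def)
    then show "energy N b (flip t) \<le> energy N b s"
      using flip_energy[of s] flip_energy[of "flip t"] by (simp add: flip_flip)
  qed
  have neg': "b k < 0" if "k \<in> {..<N} - {\<tau>}" for k
    using that neg[of k] a N by (auto simp: b_def)
  have K: "{..<N} - {\<tau>} = insert 0 ({1..N - 1} - {\<tau>})" using \<tau>' N by auto
  have "(\<Sum>k\<in>{1..N - 1} - {\<tau>}. inverse \<bar>b k\<bar>) = (\<Sum>k\<in>{1..N - 1} - {\<tau>}. inverse \<bar>\<alpha> k\<bar>)"
    by (intro sum.cong) (auto simp: b_def)
  then have bt: "b \<tau> * (\<Sum>k\<in>{..<N} - {\<tau>}. inverse \<bar>b k\<bar>) \<le> 1"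
    unfolding K using le a \<tau>' by (simp add: b_def)
  have f: "flip t k = flip t 0" if "k < N" for k
    by (rule weak_bond_LEC(2)[where b = b and t = "flip t", OF N \<tau>'(2) neg' bt lec that])
  show "collinear_config N t"
  proof (rule collinear_config_signs)
    show "spin_config N t" using t by (simp add: is_LEC_def)
    show "t k = flip t 0 \<or> t k = - flip t 0" if "k < N" for k
      using f[OF that] by (auto simp: flip_def split: if_splits)
  qed (use N in simp)
qed

end

section \<open>The family with a weakest negative bond\<close>

lemma sin_add_le: "0 \<le> x \<Longrightarrow> x \<le> pi \<Longrightarrow> 0 \<le> y \<Longrightarrow> y \<le> pi \<Longrightarrow> sin (x + y) \<le> sin x + sin y"
  unfolding sin_add
  using mult_left_le[of "cos y" "sin x"] mult_left_le[of "cos x" "sin y"] sin_ge_zero[of x] sin_ge_zero[of y]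
  by (simp add: mult.commute)

lemma sin_sum_le:
  assumes "finite A" "\<And>k. k \<in> A \<Longrightarrow> 0 \<le> y k" "sum y A \<le> pi"
  shows "sin (sum y A) \<le> (\<Sum>k\<in>A. sin (y k))"
  using assms
proof (induction A rule: finite_induct)
  case (insert k A)
  have nn: "0 \<le> sum y A" "0 \<le> y k" using insert.prems by (auto intro: sum_nonneg)
  moreover have "y k + sum y A \<le> pi" using insert by simp
  ultimately have le: "y k \<le> pi" "sum y A \<le> pi" by linarith+
  have "sin (y k + sum y A) \<le> sin (y k) + sin (sum y A)"
    using nn le by (intro sin_add_le)
  also have "\<dots> \<le> sin (y k) + (\<Sum>k\<in>A. sin (y k))"
    using insert.IH insert.prems(1) le by simp
  finally show ?case using insert by simp
qed simp

lemma sin_sum_less: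
  assumes A: "finite A" "card A \<ge> 2" and y: "\<And>k. k \<in> A \<Longrightarrow> 0 < y k" and p: "sum y A < pi"
  shows "sin (sum y A) < (\<Sum>k\<in>A. sin (y k))"
proof -
  obtain k where k: "k \<in> A" using A by fastforce
  have "A - {k} \<noteq> {}"
    using A k by (metis One_nat_def Suc_1 card.empty card_Suc_Diff1 not_less_eq_eq order_refl)
  then have r: "0 < sum y (A - {k})" using A y by (intro sum_pos) auto
  have s: "sum y A = y k + sum y (A - {k})" using A k by (simp add: sum.remove)
  have yk: "0 < y k" "y k < pi" using y[OF k] p r s by auto
  have sr: "0 < sin (sum y (A - {k}))" using r p s yk by (intro sin_gt_zero) auto
  have "cos (y k) < 1" using cos_monotone_0_pi[of 0 "y k"] yk by simp
  have "sin (y k) * cos (sum y (A - {k})) \<le> sin (y k)"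
    using sin_gt_zero[OF yk] by (intro mult_left_le) auto
  moreover have "cos (y k) * sin (sum y (A - {k})) < 1 * sin (sum y (A - {k}))"
    using \<open>cos (y k) < 1\<close> sr by (intro mult_strict_right_mono)
  ultimately have "sin (sum y A) < sin (y k) + sin (sum y (A - {k}))"
    unfolding s sin_add by linarith
  also have "\<dots> \<le> sin (y k) + (\<Sum>k\<in>A - {k}. sin (y k))"
    using A y p s yk by (intro add_left_mono sin_sum_le) (auto intro: less_imp_le)
  also have "\<dots> = (\<Sum>k\<in>A. sin (y k))" using A k by (simp add: sum.remove)
  finally show ?thesis .
qed

section \<open>Critical angles parametrized by the angle at the weakest bond\<close>

locale weakest_bond = spin_family N \<alpha> for N \<alpha> +
  fixes \<tau> :: nat
  assumes N3: "N > 3" and \<tau>: "\<tau> \<in> {1..N - 1}"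
    and weakest: "k \<in> {1..N - 1} \<Longrightarrow> \<bar>\<alpha> \<tau>\<bar> \<le> \<bar>\<alpha> k\<bar>"
begin

abbreviation "M \<equiv> {1..N - 1} - {\<tau>}"
abbreviation "C \<equiv> \<bar>\<alpha> \<tau>\<bar>"

text \<open>The inverse of \<open>alpha_d\<close>; \<open>C * R\<close> is the slope of
  \<open>g\<close> at 0.\<close>

definition R :: real where "R = (\<Sum>k\<in>M. inverse \<bar>\<alpha> k\<bar>)"

text \<open>The sum of the angles at the bonds other than \<open>\<tau>\<close> when the Lagrange
  parameter is \<open>C * sin t\<close>.\<close>

definition g :: "real \<Rightarrow> real" where "g t = (\<Sum>k\<in>M. arcsin (C / \<bar>\<alpha> k\<bar> * sin t))"

definition angles :: "real \<Rightarrow> nat \<Rightarrow> real" where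
  "angles t k = (if k = \<tau> then t else arcsin (C / \<bar>\<alpha> k\<bar> * sin t))"

lemma M: "finite M" "card M \<ge> 2" "M \<noteq> {}"
proof -
  show "card M \<ge> 2" using N3 \<tau> by simp
  then show "M \<noteq> {}" by (metis card.empty not_numeral_le_zero)
qed simp

lemma alpha_nz: "k \<in> {1..N - 1} \<Longrightarrow> \<bar>\<alpha> k\<bar> > 0"
  using neg by force

lemma C_pos: "C > 0" using alpha_nz[OF \<tau>] .

lemma R_pos: "R > 0" unfolding R_def using M alpha_nz by (intro sum_pos) auto

lemma ratio: "k \<in> M \<Longrightarrow> 0 < C / \<bar>\<alpha> k\<bar>" "k \<in> M \<Longrightarrow> C / \<bar>\<alpha> k\<bar> \<le> 1"
  using weakest[of k] alpha_nz[of k] C_pos by auto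

lemma ratio_sin: "k \<in> M \<Longrightarrow> \<bar>C / \<bar>\<alpha> k\<bar> * sin t\<bar> \<le> 1"
  using ratio[of k] mult_mono[of "C / \<bar>\<alpha> k\<bar>" 1 "\<bar>sin t\<bar>" 1] by (simp add: abs_mult)

lemma ratio_sin_bounds: "k \<in> M \<Longrightarrow> - 1 \<le> C / \<bar>\<alpha> k\<bar> * sin t" "k \<in> M \<Longrightarrow> C / \<bar>\<alpha> k\<bar> * sin t \<le> 1"
  using ratio_sin[of k t] by linarith+

lemma g_0: "g 0 = 0" by (simp add: g_def)

text \<open>Carries questions about \<open>t\<close> near \<open>pi\<close> to \<open>t\<close> near
  0, where the slope of \<open>g\<close> is known.\<close>

lemma g_reflect: "g (pi - t) = g t" by (simp add: g_def)

lemma continuous_g: "continuous_on A g"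
  unfolding g_def using ratio_sin_bounds by (intro continuous_intros) auto

lemma g_deriv: "(g has_real_derivative C * R) (at 0)"
proof -
  have "((\<lambda>t. arcsin (C / \<bar>\<alpha> k\<bar> * sin t)) has_real_derivative C * inverse \<bar>\<alpha> k\<bar>) (at 0)" for k
    by (auto intro!: derivative_eq_intros simp: divide_inverse)
  then show ?thesis unfolding g_def[abs_def] R_def sum_distrib_left by (intro DERIV_sum)
qed

lemma arcsin_ratio_pos:
  assumes "k \<in> M" "0 < t" "t < pi"
  shows "0 < arcsin (C / \<bar>\<alpha> k\<bar> * sin t)"
proof -
  have "0 < C / \<bar>\<alpha> k\<bar> * sin t" using ratio(1)[OF assms(1)] sin_gt_zero[OF assms(2,3)] by (rule mult_pos_pos)
  then show ?thesis using arcsin_less_arcsin[of 0] ratio_sin_bounds[OF assms(1), of t] by simp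
qed

lemma g_pos: "0 < t \<Longrightarrow> t < pi \<Longrightarrow> 0 < g t"
  unfolding g_def using M arcsin_ratio_pos by (intro sum_pos) auto

lemma sum_angles: "sum (angles t) {1..N - 1} = t + g t"
  unfolding sum.remove[OF finite_atLeastAtMost \<tau>] g_def by (simp add: angles_def)

text \<open>By the choice of the arcsines every bond in \<open>M\<close> satisfies
  \<open>\<bar>\<alpha> k\<bar> * sin (angles t k) = C * sin t\<close>, so a single equation in
  \<open>t\<close> remains.\<close>

lemma critical_angles:
  assumes t: "0 < t" "t < pi" "t + g t < pi" "C * sin t = a * sin (t + g t)"
  shows "critical a (angles t)"
  unfolding critical_def sum_angles
proof (intro conjI ballI)
  show "t + g t < pi" using t(3) .
  fix k assume k: "k \<in> {1..N - 1}"
  show "0 < angles t k" using k t arcsin_ratio_pos[of k t] by (auto simp: angles_def)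
  show "\<bar>\<alpha> k\<bar> * sin (angles t k) = a * sin (t + g t)"
  proof (cases "k = \<tau>")
    case False
    then have "k \<in> M" using k by auto
    then show ?thesis using False t(4) alpha_nz[OF k] ratio_sin_bounds[of k t] by (simp add: angles_def)
  qed (use t(4) in \<open>simp add: angles_def\<close>)
qed

text \<open>Capping the total angle at \<^term>\<open>pi\<close> makes the right-hand side vanish where the angle is too
  large, so a zero found by the intermediate value theorem automatically has total angle below
  \<^term>\<open>pi\<close>.\<close>

lemma ex_critical_below:
  assumes b: "0 < b" "b < pi" and a: "a > 0" "a * (inverse C + R) > 1"
    and gb: "a * sin (min (b + g b) pi) < C * sin b"
  shows "\<exists>t. 0 < t \<and> t < b \<and> t + g t < pi \<and> C * sin t = a * sin (t + g t)"
proof -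
  define f where "f t = a * sin (t + g t) - C * sin t" for t
  define h where "h t = a * sin (min (t + g t) pi) - C * sin t" for t
  have "(f has_real_derivative a * (1 + C * R) - C) (at 0)"
    unfolding f_def[abs_def] by (rule derivative_eq_intros g_deriv refl | simp add: g_0)+
  \<comment> \<open>The second assumption on \<open>a\<close>, multiplied by \<open>C\<close>:
    initially \<open>f\<close> increases from 0.\<close>
  moreover have "a * (1 + C * R) - C > 0"
    using a(2) C_pos by (simp add: field_simps)
  ultimately obtain d where d: "d > 0" "\<And>x. 0 < x \<Longrightarrow> x < d \<Longrightarrow> f 0 < f (0 + x)"
    using DERIV_pos_inc_right by blast
  have "isCont (\<lambda>t. t + g t) 0" using DERIV_isCont[OF g_deriv] by (intro continuous_intros)
  then have "((\<lambda>t. t + g t) \<longlongrightarrow> 0) (at 0)" by (simp add: isCont_def g_0)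
  then have "eventually (\<lambda>t. t + g t < pi) (at 0)" by (rule order_tendstoD) simp
  then obtain e where e: "e > 0" "\<And>x. x \<noteq> 0 \<Longrightarrow> dist x 0 < e \<Longrightarrow> x + g x < pi"
    unfolding eventually_at by blast
  \<comment> \<open>Small enough that \<open>f\<close> is positive, the cap at \<open>pi\<close> is
    inactive, and \<open>x\<close> lies left of \<open>b\<close>.\<close>
  define x where "x = min (min d e) b / 2"
  have x: "0 < x" "x < d" "x < e" "x < b" using d(1) e(1) b by (auto simp: x_def)
  have "x + g x < pi" using e(2)[of x] x by simp
  then have "h x = f x" by (simp add: h_def f_def)
  then have hx: "0 < h x" using d(2)[of x] x by (simp add: f_def g_0)
  have "continuous_on {x..b} h" unfolding h_def by (intro continuous_intros continuous_g)
  moreover have hb: "h b < 0" using gb by (simp add: h_def)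
  ultimately obtain t where t: "x \<le> t" "t \<le> b" "h t = 0"
    using IVT2'[of h b 0 x] hx x by auto
  have tb: "t < b" using t hb by (cases "t = b") auto
  have tp: "0 < t" "t < pi" using t x b by auto
  have "0 < C * sin t" using C_pos sin_gt_zero[OF tp] by simp
  then have "sin (min (t + g t) pi) \<noteq> 0" using t(3) by (auto simp: h_def)
  then have "t + g t < pi" by (cases "t + g t < pi") auto
  then show ?thesis using t(3) tb tp by (intro exI[of _ t]) (simp add: h_def)
qed

text \<open>The third assumption is a slope condition at \<open>t = pi\<close>: reflection turns
  \<open>sin (t + g t)\<close> at \<open>t = pi - x\<close> into \<open>sin (x - g x)\<close>. For
  small \<open>x\<close> this makes \<open>b = pi - x\<close> admissible in
  \<open>ex_critical_below\<close>.\<close>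

lemma ex_critical:
  assumes a: "a > 0" "a * (inverse C + R) > 1" "a * (inverse C - R) < 1"
  shows "\<exists>t. 0 < t \<and> t < pi \<and> t + g t < pi \<and> C * sin t = a * sin (t + g t)"
proof -
  define f where "f t = a * sin (t - g t) - C * sin t" for t
  have "(f has_real_derivative a * (1 - C * R) - C) (at 0)"
    unfolding f_def[abs_def] by (rule derivative_eq_intros g_deriv refl | simp add: g_0)+
  moreover have "a * (1 - C * R) - C < 0"
    using a(3) C_pos by (simp add: field_simps)
  ultimately obtain d where d: "d > 0" "\<And>x. 0 < x \<Longrightarrow> x < d \<Longrightarrow> f 0 > f (0 + x)"
    using DERIV_neg_dec_right by blast
  define x where "x = min d pi / 2"
  have x: "0 < x" "x < d" "x < pi" using d(1) by (auto simp: x_def min_def)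
  have fx: "a * sin (x - g x) < C * sin x" using d(2)[of x] x by (simp add: f_def g_0)
  let ?b = "pi - x"
  have "a * sin (min (?b + g ?b) pi) < C * sin ?b"
  proof (cases "?b + g ?b < pi")
    case True
    have "sin (?b + g ?b) = sin (pi - (x - g x))" by (simp add: g_reflect algebra_simps)
    also have "\<dots> = sin (x - g x)" by (rule sin_pi_minus)
    finally show ?thesis using True fx by simp
  next
    case False
    then show ?thesis using C_pos sin_gt_zero[of x] x by simp
  qed
  then show ?thesis using ex_critical_below[of ?b a] a x by force
qed

section \<open>Location of the phase transitions\<close>

lemma sum_inverse: "(\<Sum>k = 1..N - 1. inverse \<bar>\<alpha> k\<bar>) = inverse C + R"
  unfolding sum.remove[OF finite_atLeastAtMost \<tau>] R_def ..

definition a0 :: real where "a0 = inverse (inverse C + R)"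

lemma a0_pos: "a0 > 0" using C_pos R_pos by (simp add: a0_def add_pos_pos)

lemma a0_iff: "a * (inverse C + R) \<le> 1 \<longleftrightarrow> a \<le> a0"
proof -
  have "inverse C + R > 0" using C_pos R_pos by (simp add: add_pos_pos)
  then show ?thesis by (simp add: a0_def field_simps)
qed

lemma below_a0:
  assumes "0 < a" "a \<le> a0"
  shows "LEC_collinear N (\<alpha>(0 := a))" "\<not> LEC_coplanar N (\<alpha>(0 := a))" "lagrange_param N \<alpha> a = 0"
  using flat_types[of a] assms unfolding sum_inverse a0_iff by simp_all

lemma above_a0:
  assumes "a0 < a" "a * (inverse C - R) < 1"
  shows "LEC_coplanar N (\<alpha>(0 := a))" "\<not> LEC_collinear N (\<alpha>(0 := a))"
    and "lagrange_param N \<alpha> a \<le> C"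
proof -
  have a: "a > 0" "a * (inverse C + R) > 1" using assms a0_pos a0_iff[of a] by auto
  obtain t where t: "0 < t" "t < pi" "t + g t < pi" "C * sin t = a * sin (t + g t)"
    using ex_critical[OF a assms(2)] by blast
  note c = critical_types[OF critical_angles[OF t] a(1), unfolded sum_angles t(4)[symmetric]]
  show "LEC_coplanar N (\<alpha>(0 := a))" "\<not> LEC_collinear N (\<alpha>(0 := a))" using c by auto
  show "lagrange_param N \<alpha> a \<le> C" using c(3) mult_left_le[of "sin t" C] by simp
qed

text \<open>Conversely to solving for \<open>t\<close>, any \<open>t\<close> with total angle below
  \<open>pi\<close> becomes critical once \<open>a\<close> is read off from the Lagrange
  condition.\<close>

lemma lagrange_param_angle:
  assumes t: "0 < t" "t < pi" "t + g t < pi"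
  shows "lagrange_param N \<alpha> (C * sin t / sin (t + g t)) = C * sin t" "0 < C * sin t / sin (t + g t)"
proof -
  have s: "sin (t + g t) > 0" using t g_pos[OF t(1,2)] by (intro sin_gt_zero) auto
  show pos: "0 < C * sin t / sin (t + g t)" using s C_pos sin_gt_zero[OF t(1,2)] by simp
  have e: "C * sin t = (C * sin t / sin (t + g t)) * sin (t + g t)" using s by simp
  show "lagrange_param N \<alpha> (C * sin t / sin (t + g t)) = C * sin t"
    using critical_types(3)[OF critical_angles[OF t e] pos] s unfolding sum_angles by simp
qed

text \<open>Now \<open>inverse C - R \<le> 0\<close>, so the upper condition of
  \<open>above_a0\<close> holds for every positive \<open>a\<close>, and the two phases are
  half-lines meeting at \<open>a0\<close>.\<close>

lemma phase_transition_strong: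
  assumes "C * R \<ge> 1"
  shows "phase_transition N \<alpha> a \<longleftrightarrow> a = a0"
proof -
  have "inverse C - R \<le> 0" using assms C_pos by (simp add: field_simps)
  then have *: "a * (inverse C - R) < 1" if "a > 0" for a
    using that mult_nonneg_nonpos[of a "inverse C - R"] by simp
  have col: "{a. a > 0 \<and> LEC_collinear N (\<alpha>(0 := a))} = {0<..a0}"
    using below_a0(1) above_a0(2) a0_pos * by (force simp: not_le)
  have cop: "{a. a > 0 \<and> LEC_coplanar N (\<alpha>(0 := a))} = {a0<..}"
    using below_a0(2) above_a0(1) a0_pos * by (force simp: not_le)
  show ?thesis
    unfolding phase_transition_def col cop using a0_pos by auto
qed

text \<open>For \<open>a \<ge> a1\<close> the upper condition fails, which is exactly the hypothesis
  of \<open>LEC_collinear_weak_bond\<close>; so a second transition occurs at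
  \<open>a1\<close>.\<close>

lemma not_type_I_weak:
  assumes "C * R < 1"
  shows "\<not> type_I N \<alpha>"
proof -
  define a1 where "a1 = inverse (inverse C - R)"
  have p: "inverse C - R > 0" using assms C_pos by (simp add: field_simps)
  have a1: "a0 < a1" unfolding a0_def a1_def using p R_pos by (intro less_imp_inverse_less) auto
  have a1_iff: "a * (inverse C - R) < 1 \<longleftrightarrow> a < a1" for a
    using p by (simp add: a1_def field_simps)
  have cop: "{a0<..<a1} \<subseteq> {a. a > 0 \<and> LEC_coplanar N (\<alpha>(0 := a))}"
    using above_a0(1) a0_pos by (auto simp: a1_iff)
  have col0: "{0<..<a0} \<subseteq> {a. a > 0 \<and> LEC_collinear N (\<alpha>(0 := a))}"
    using below_a0(1) by auto
  have col1: "{a1<..} \<subseteq> {a. a > 0 \<and> LEC_collinear N (\<alpha>(0 := a))}"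
  proof
    fix a assume a: "a \<in> {a1<..}"
    then have a': "a > 0" using a1 a0_pos by auto
    have "1 \<le> a * (inverse C - R)" using a1_iff[of a] a by auto
    then have "C * (inverse a + R) \<le> 1" using a' C_pos by (simp add: field_simps)
    then show "a \<in> {a. a > 0 \<and> LEC_collinear N (\<alpha>(0 := a))}"
      using LEC_collinear_weak_bond[OF \<tau> a'] a' by (simp add: R_def)
  qed
  have "a0 \<in> closure {0<..<a0}" "a0 \<in> closure {a0<..<a1}" "a1 \<in> closure {a0<..<a1}" "a1 \<in> closure {a1<..}"
    using a0_pos a1 by auto
  then have "phase_transition N \<alpha> a0" "phase_transition N \<alpha> a1"
    unfolding phase_transition_def using a0_pos a1 closure_mono[OF cop] closure_mono[OF col0] closure_mono[OF col1]
    by auto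
  then show ?thesis using a1 by (auto simp: type_I_def)
qed

lemma type_I_iff: "type_I N \<alpha> \<longleftrightarrow> C * R \<ge> 1"
proof
  show "type_I N \<alpha> \<Longrightarrow> C * R \<ge> 1" using not_type_I_weak by linarith
  show "type_I N \<alpha>" if "C * R \<ge> 1"
    unfolding type_I_def phase_transition_strong[OF that] by simp
qed

section \<open>Attainment of the maximal Lagrange parameter\<close>

lemma lagrange_param_attains_max:
  assumes "C * R \<ge> 1" "g (pi / 2) < pi / 2"
  shows "\<exists>a>0. \<forall>a'>0. lagrange_param N \<alpha> a' \<le> lagrange_param N \<alpha> a"
proof -
  have "inverse C - R \<le> 0" using assms C_pos by (simp add: field_simps)
  then have *: "a * (inverse C - R) < 1" if "a > 0" for a
    using that mult_nonneg_nonpos[of a "inverse C - R"] by simp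
  have "lagrange_param N \<alpha> a \<le> C" if "a > 0" for a
    using below_a0(3)[of a] above_a0(3)[of a] *[of a] C_pos that by (cases "a \<le> a0") auto
  \<comment> \<open>The bound \<open>C\<close> is attained at \<open>t = pi / 2\<close>, whose total
    angle is below \<open>pi\<close> by the second assumption.\<close>
  then show ?thesis using lagrange_param_angle[of "pi / 2"] assms(2) by (intro exI) auto
qed

text \<open>Every value is \<open>C * sin t\<close> with \<open>t < pi / 2\<close> and
  \<open>t + g t < pi\<close>. Both conditions are open, so a slightly larger angle is still
  admissible and gives a larger value.\<close>

lemma lagrange_param_no_max:
  assumes g: "g (pi / 2) \<ge> pi / 2" and a: "a > 0"
  shows "\<exists>a'>0. lagrange_param N \<alpha> a < lagrange_param N \<alpha> a'"
proof -
  obtain t where t: "0 \<le> t" "t < pi / 2" "t + g t < pi" "lagrange_param N \<alpha> a = C * sin t"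
  proof (cases "a \<le> a0")
    case True
    then show ?thesis using that[of 0] below_a0(3)[OF a] by (simp add: g_0)
  next
    case False
    then have "a * (inverse C + R) > 1" using a0_iff[of a] by simp
    \<comment> \<open>By assumption the capped angle is \<open>pi\<close>, so the left side is 0 and
      the zero found lies below \<open>pi / 2\<close>.\<close>
    moreover have "a * sin (min (pi / 2 + g (pi / 2)) pi) < C * sin (pi / 2)" using g C_pos by simp
    ultimately obtain t where t: "0 < t" "t < pi / 2" "t + g t < pi" "C * sin t = a * sin (t + g t)"
      using ex_critical_below[of "pi / 2" a] a by auto
    have "t < pi" using t by simp
    have "lagrange_param N \<alpha> a = C * sin t"
      using critical_types(3)[OF critical_angles[OF t(1) \<open>t < pi\<close> t(3,4)] a] t(4) unfolding sum_angles by simp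
    then show ?thesis using that[of t] t by simp
  qed
  have "isCont (\<lambda>t. t + g t) t"
    using continuous_g[of UNIV] by (intro continuous_intros) (simp add: continuous_on_eq_continuous_at)
  then have "((\<lambda>t. t + g t) \<longlongrightarrow> t + g t) (at_right t)"
    unfolding isCont_def by (rule tendsto_within_subset) simp
  then have "eventually (\<lambda>x. x + g x < pi) (at_right t)" using t(3) by (rule order_tendstoD)
  moreover have "eventually (\<lambda>x. x < pi / 2) (at_right t)"
    using tendsto_ident_at t(2) by (rule order_tendstoD)
  ultimately have "eventually (\<lambda>x. x + g x < pi \<and> x < pi / 2 \<and> t < x) (at_right t)"
    using eventually_at_right_less[of t] by eventually_elim auto
  then obtain x where x: "x + g x < pi" "x < pi / 2" "t < x"
    using eventually_happens'[OF trivial_limit_at_right_real] by blast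
  have "sin t < sin x" using x t by (intro sin_monotone_2pi) auto
  then have "lagrange_param N \<alpha> a < C * sin x" using t(4) C_pos by simp
  then show ?thesis using lagrange_param_angle[of x] x t(1) by (intro exI[of _ "C * sin x / sin (x + g x)"]) auto
qed

lemma type_I_beta_iff: "type_I_beta N \<alpha> \<longleftrightarrow> C * R \<ge> 1 \<and> g (pi / 2) < pi / 2"
  unfolding type_I_beta_def type_I_iff
proof (intro conj_cong refl iffI)
  show "g (pi / 2) < pi / 2" if "\<exists>a>0. \<forall>a'>0. lagrange_param N \<alpha> a' \<le> lagrange_param N \<alpha> a"
    using that lagrange_param_no_max by (meson not_le)
qed (use lagrange_param_attains_max in blast)

subsection \<open>The thresholds\<close>

lemma alpha_sigma_le: "k \<in> M \<Longrightarrow> alpha_sigma N \<tau> \<alpha> \<le> \<bar>\<alpha> k\<bar>"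
  unfolding alpha_sigma_def using M by (intro Min_le) auto

lemma alpha_sigma_attained: obtains k where "k \<in> M" "alpha_sigma N \<tau> \<alpha> = \<bar>\<alpha> k\<bar>"
proof -
  have "alpha_sigma N \<tau> \<alpha> \<in> (\<lambda>k. \<bar>\<alpha> k\<bar>) ` M"
    unfolding alpha_sigma_def using M by (intro Min_in) auto
  then obtain k where "k \<in> M" "alpha_sigma N \<tau> \<alpha> = \<bar>\<alpha> k\<bar>" by (rule imageE) simp
  then show ?thesis by (rule that)
qed

lemma C_le_alpha_sigma: "C \<le> alpha_sigma N \<tau> \<alpha>"
proof -
  obtain k where "k \<in> M" "alpha_sigma N \<tau> \<alpha> = \<bar>\<alpha> k\<bar>" by (rule alpha_sigma_attained)
  then show ?thesis using weakest[of k] by simp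
qed

definition S :: "real \<Rightarrow> real" where "S x = (\<Sum>k\<in>M. arcsin (x / \<bar>\<alpha> k\<bar>))"

text \<open>Translates the angle condition at \<open>t = pi / 2\<close> into a comparison of
  \<open>C\<close> with \<open>alpha_d'\<close>, as \<open>S\<close> is increasing.\<close>

lemma S_C: "S C = g (pi / 2)" by (simp add: S_def g_def)

lemma quotient_bounds:
  assumes "k \<in> M" "0 \<le> x" "x \<le> alpha_sigma N \<tau> \<alpha>"
  shows "0 \<le> x / \<bar>\<alpha> k\<bar>" "x / \<bar>\<alpha> k\<bar> \<le> 1" "- 1 \<le> x / \<bar>\<alpha> k\<bar>"
proof -
  show "0 \<le> x / \<bar>\<alpha> k\<bar>" using assms(2) by simp
  then show "- 1 \<le> x / \<bar>\<alpha> k\<bar>" by linarith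
  show "x / \<bar>\<alpha> k\<bar> \<le> 1" using assms alpha_sigma_le[OF assms(1)] alpha_nz[of k] by auto
qed

lemma S_strict_mono:
  assumes "0 \<le> x" "x < y" "y \<le> alpha_sigma N \<tau> \<alpha>"
  shows "S x < S y"
  unfolding S_def
proof (rule sum_strict_mono)
  fix k assume k: "k \<in> M"
  have "x / \<bar>\<alpha> k\<bar> < y / \<bar>\<alpha> k\<bar>" using assms(2) alpha_nz[of k] k by (simp add: divide_strict_right_mono)
  then show "arcsin (x / \<bar>\<alpha> k\<bar>) < arcsin (y / \<bar>\<alpha> k\<bar>)"
    using quotient_bounds(3)[OF k, of x] quotient_bounds(2)[OF k, of y] assms
    by (intro arcsin_less_arcsin) auto
qed (use M in auto)

lemma S_0: "S 0 = 0" by (simp add: S_def)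

text \<open>A bond attaining the minimum contributes \<open>arcsin 1 = pi / 2\<close>, and at least
  one further bond contributes a positive amount.\<close>

lemma S_alpha_sigma: "S (alpha_sigma N \<tau> \<alpha>) > pi / 2"
proof -
  obtain k where k: "k \<in> M" "alpha_sigma N \<tau> \<alpha> = \<bar>\<alpha> k\<bar>" by (rule alpha_sigma_attained)
  have "M - {k} \<noteq> {}"
    using M k(1) by (metis One_nat_def Suc_1 card.empty card_Suc_Diff1 not_less_eq_eq order_refl)
  moreover have "0 < arcsin (alpha_sigma N \<tau> \<alpha> / \<bar>\<alpha> j\<bar>)" if "j \<in> M" for j
  proof -
    have "0 < alpha_sigma N \<tau> \<alpha> / \<bar>\<alpha> j\<bar>" using C_pos C_le_alpha_sigma alpha_nz[of j] that by simp
    moreover have "alpha_sigma N \<tau> \<alpha> / \<bar>\<alpha> j\<bar> \<le> 1"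
      using quotient_bounds[OF that, of "alpha_sigma N \<tau> \<alpha>"] C_pos C_le_alpha_sigma by simp
    ultimately show ?thesis using arcsin_less_arcsin[of 0] by simp
  qed
  ultimately have "0 < (\<Sum>j\<in>M - {k}. arcsin (alpha_sigma N \<tau> \<alpha> / \<bar>\<alpha> j\<bar>))"
    using M by (intro sum_pos) auto
  then show ?thesis
    unfolding S_def sum.remove[OF M(1) k(1)] using k alpha_nz[of k] by simp
qed

lemma continuous_S: "continuous_on {0..alpha_sigma N \<tau> \<alpha>} S"
  unfolding S_def
proof (intro continuous_on_sum continuous_on_arcsin' continuous_intros ballI conjI)
  fix k x assume k: "k \<in> M" and x: "x \<in> {0..alpha_sigma N \<tau> \<alpha>}"
  then show "- 1 \<le> x / \<bar>\<alpha> k\<bar>" "x / \<bar>\<alpha> k\<bar> \<le> 1" "\<bar>\<alpha> k\<bar> \<noteq> 0"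
    using quotient_bounds(2,3)[OF k, of x] alpha_nz[of k] by (simp_all del: divide_le_eq_1)
qed

lemma arcsin_sum_eq_iff:
  "arcsin_sum_eq N \<tau> \<alpha> x \<longleftrightarrow> 0 < x \<and> x < alpha_sigma N \<tau> \<alpha> \<and> S x = pi / 2"
proof
  assume x: "arcsin_sum_eq N \<tau> \<alpha> x"
  then have dom: "- 1 \<le> x / \<bar>\<alpha> k\<bar>" "x / \<bar>\<alpha> k\<bar> \<le> 1" if "k \<in> M" for k
    using that by (auto simp: arcsin_sum_eq_def)
  have S: "S x = pi / 2" using x by (simp add: arcsin_sum_eq_def S_def)
  have "0 < x"
  proof (rule ccontr)
    assume "\<not> 0 < x"
    then have "S x \<le> 0" unfolding S_def
      using arcsin_le_arcsin[of _ 0] dom by (intro sum_nonpos) (auto simp: divide_le_0_iff)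
    then show False using S pi_gt_zero by linarith
  qed
  obtain k where k: "k \<in> M" "alpha_sigma N \<tau> \<alpha> = \<bar>\<alpha> k\<bar>" by (rule alpha_sigma_attained)
  have "x \<le> alpha_sigma N \<tau> \<alpha>" using dom(2)[OF k(1)] k alpha_nz[of k] by (simp add: field_simps)
  then show "0 < x \<and> x < alpha_sigma N \<tau> \<alpha> \<and> S x = pi / 2"
    using S S_alpha_sigma \<open>0 < x\<close> by (cases "x = alpha_sigma N \<tau> \<alpha>") auto
next
  assume x: "0 < x \<and> x < alpha_sigma N \<tau> \<alpha> \<and> S x = pi / 2"
  have "x / \<bar>\<alpha> k\<bar> \<in> {- 1..1}" if "k \<in> M" for k
    using quotient_bounds(2,3)[OF that, of x] x by (simp only: atLeastAtMost_iff) simp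
  then show "arcsin_sum_eq N \<tau> \<alpha> x" using x by (simp add: arcsin_sum_eq_def S_def)
qed

lemma ex1_arcsin_sum_eq: "\<exists>!x. arcsin_sum_eq N \<tau> \<alpha> x"
proof -
  have "\<exists>x\<ge>0. x \<le> alpha_sigma N \<tau> \<alpha> \<and> S x = pi / 2"
    using continuous_S S_0 S_alpha_sigma C_pos C_le_alpha_sigma by (intro IVT') auto
  then obtain x where x: "0 \<le> x" "x \<le> alpha_sigma N \<tau> \<alpha>" "S x = pi / 2" by blast
  have "x \<noteq> 0" "x \<noteq> alpha_sigma N \<tau> \<alpha>" using x(3) S_0 S_alpha_sigma by auto
  then have "arcsin_sum_eq N \<tau> \<alpha> x" using x by (simp add: arcsin_sum_eq_iff)
  moreover have "y = z" if "arcsin_sum_eq N \<tau> \<alpha> y" "arcsin_sum_eq N \<tau> \<alpha> z" for y z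
    using that S_strict_mono[of y z] S_strict_mono[of z y]
    unfolding arcsin_sum_eq_iff by (cases y z rule: linorder_cases) auto
  ultimately show ?thesis by blast
qed

lemma alpha_d'_props:
  "0 < alpha_d' N \<tau> \<alpha>" "alpha_d' N \<tau> \<alpha> < alpha_sigma N \<tau> \<alpha>" "S (alpha_d' N \<tau> \<alpha>) = pi / 2"
  using theI'[OF ex1_arcsin_sum_eq] unfolding alpha_d'_def arcsin_sum_eq_iff by auto

lemma less_alpha_d'_iff: "C < alpha_d' N \<tau> \<alpha> \<longleftrightarrow> g (pi / 2) < pi / 2"
  using S_strict_mono[of C "alpha_d' N \<tau> \<alpha>"] S_strict_mono[of "alpha_d' N \<tau> \<alpha>" C]
    alpha_d'_props C_pos C_le_alpha_sigma S_C
  by (cases C "alpha_d' N \<tau> \<alpha>" rule: linorder_cases) auto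

lemma alpha_d_eq: "alpha_d N \<tau> \<alpha> = inverse R" by (simp add: alpha_d_def R_def)

lemma less_alpha_d_iff: "C < alpha_d N \<tau> \<alpha> \<longleftrightarrow> C * R < 1"
  using R_pos by (simp add: alpha_d_eq field_simps)

text \<open>The sine of the defining equation of \<open>alpha_d'\<close> is 1, while strict
  subadditivity bounds it by the sum of the sines, which is \<open>alpha_d' * R\<close>.\<close>

lemma alpha_d_less: "alpha_d N \<tau> \<alpha> < alpha_d' N \<tau> \<alpha>"
proof -
  let ?x = "alpha_d' N \<tau> \<alpha>" and ?y = "\<lambda>k. arcsin (alpha_d' N \<tau> \<alpha> / \<bar>\<alpha> k\<bar>)"
  have b: "0 < ?x / \<bar>\<alpha> k\<bar>" "?x / \<bar>\<alpha> k\<bar> \<le> 1" if "k \<in> M" for k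
    using quotient_bounds[OF that, of ?x] alpha_d'_props alpha_nz[of k] that by auto
  have "1 = sin (sum ?y M)" using alpha_d'_props(3) unfolding S_def by (simp only: sin_pi_half)
  also have "\<dots> < (\<Sum>k\<in>M. sin (?y k))"
  proof (rule sin_sum_less)
    show "0 < ?y k" if "k \<in> M" for k using b[OF that] arcsin_less_arcsin[of 0 "?x / \<bar>\<alpha> k\<bar>"] by simp
    show "sum ?y M < pi" using alpha_d'_props(3) pi_gt_zero unfolding S_def by linarith
  qed (use M in auto)
  also have "\<dots> = (\<Sum>k\<in>M. ?x * inverse \<bar>\<alpha> k\<bar>)"
  proof (intro sum.cong refl)
    show "sin (?y k) = ?x * inverse \<bar>\<alpha> k\<bar>" if "k \<in> M" for k
      using b[OF that] by (simp add: divide_inverse)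
  qed
  also have "\<dots> = ?x * R" by (simp add: R_def sum_distrib_left)
  finally show ?thesis using R_pos by (simp add: alpha_d_eq field_simps)
qed

end

theorem theorem3:
  fixes N \<tau> :: nat and \<alpha> :: "nat \<Rightarrow> real"
  assumes "N > 3"
    and "\<tau> \<in> {1..N - 1}"
    and "\<And>\<mu>. \<mu> \<in> {1..N - 1} - {\<tau>} \<Longrightarrow> \<alpha> \<mu> < 0"
    and "\<alpha> \<tau> < 0"
    and "\<bar>\<alpha> \<tau>\<bar> \<le> alpha_sigma N \<tau> \<alpha>"
  shows "(\<exists>!x. arcsin_sum_eq N \<tau> \<alpha> x) \<and>
         0 < alpha_d N \<tau> \<alpha> \<and> alpha_d N \<tau> \<alpha> < alpha_d' N \<tau> \<alpha> \<and>
         alpha_d' N \<tau> \<alpha> < alpha_sigma N \<tau> \<alpha> \<and>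
         (0 < \<bar>\<alpha> \<tau>\<bar> \<and> \<bar>\<alpha> \<tau>\<bar> < alpha_d N \<tau> \<alpha> \<longleftrightarrow> type_II N \<alpha>) \<and>
         (alpha_d N \<tau> \<alpha> \<le> \<bar>\<alpha> \<tau>\<bar> \<and> \<bar>\<alpha> \<tau>\<bar> < alpha_d' N \<tau> \<alpha> \<longleftrightarrow> type_I_beta N \<alpha>) \<and>
         (alpha_d' N \<tau> \<alpha> \<le> \<bar>\<alpha> \<tau>\<bar> \<and> \<bar>\<alpha> \<tau>\<bar> \<le> alpha_sigma N \<tau> \<alpha> \<longleftrightarrow> type_I_alpha N \<alpha>)"
proof -
  have le: "\<bar>\<alpha> \<tau>\<bar> \<le> \<bar>\<alpha> k\<bar>" if "k \<in> {1..N - 1}" for k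
  proof (cases "k = \<tau>")
    case False
    then have "alpha_sigma N \<tau> \<alpha> \<le> \<bar>\<alpha> k\<bar>"
      unfolding alpha_sigma_def using that by (intro Min_le) auto
    then show ?thesis using assms(5) by linarith
  qed simp
  interpret weakest_bond N \<alpha> \<tau>
    using assms(1-4) le by unfold_locales auto
  have "type_II N \<alpha> \<longleftrightarrow> C < alpha_d N \<tau> \<alpha>"
    unfolding type_II_def type_I_iff less_alpha_d_iff by auto
  moreover have "type_I_beta N \<alpha> \<longleftrightarrow> alpha_d N \<tau> \<alpha> \<le> C \<and> C < alpha_d' N \<tau> \<alpha>"
    unfolding type_I_beta_iff less_alpha_d'_iff using less_alpha_d_iff by auto
  moreover have "type_I N \<alpha> \<longleftrightarrow> alpha_d N \<tau> \<alpha> \<le> C"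
    unfolding type_I_iff using less_alpha_d_iff by auto
  moreover have "0 < alpha_d N \<tau> \<alpha>" using R_pos by (simp add: alpha_d_eq)
  ultimately show ?thesis
    using ex1_arcsin_sum_eq alpha_d_less alpha_d'_props(2) C_pos C_le_alpha_sigma
    unfolding type_I_alpha_def by auto
qed

end
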